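(* Suppose that $(X,d,\mu)$ is a geometrically doubling metric measure space with $\sup\{\mu(B(x,1)):x\in X\}<\infty$. Moreover, assume that $\mu$ is lower Ahlfors $Q(\cdot)$-regular for some $Q\in\mathcal{P}_b^{\log}(X)$. Suppose that $H\subseteq\mathrm{Iso}_\mu(X,d)$ is such that there exist $x_0\in X$ and $r\in(0,\infty)$ satisfying $$\lim_{R\to\infty}\ \inf_{x\in X\setminus B(x_0,R)}M_H(x,r)=\infty.$$ Then, for all $p\in\mathcal{P}_b^{\log}(X)\cap\mathcal{P}_H(X)$ and $s\in\mathcal{P}_b^{\log}(X)$ such that $s^+\le1$ and $sp\ll Q$, we have the compact embedding $$M^{s(\cdot),p(\cdot)}_H(X,d,\mu)\hookrightarrow\hookrightarrow L^{q(\cdot)}(X,\mu)$$ for all $q\in\mathcal{P}_b(X)$ satisfying $p\ll q\ll\gamma$, where $\gamma=Qp/(Q-sp)$.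
   Context: A metric measure space $(X,d,\mu)$ is a metric space $(X,d)$ with a Borel measure $\mu$ such that $0<\mu(B(x,r))<\infty$ for every open ball $B(x,r)$, $x\in X$, $r\in(0,\infty)$ (in particular $X$ is separable). $(X,d)$ is geometrically doubling if there is a constant $M$ such that every ball $B(x,r)$ can be covered by at most $M$ balls of radius $r/2$. Exponents: for measurable $p$ on $X$, $p^+=\operatorname{ess\,sup}_X p$, $p^-=\operatorname{ess\,inf}_X p$. $\mathcal{P}(X)$ is the set of measurable $p:X\to(0,\infty]$ with $p^->0$; $\mathcal{P}_b(X)=\mathcal{P}(X)\cap L^\infty(X,\mu)$. $p_1\ll p_2$ means $(p_2-p_1)^->0$. $\mathcal{P}_b^{\log}(X)$ is the set of $p\in\mathcal{P}_b(X)$ such that $1/p$ is locally log-Hölder continuous: there is $C\in(0,\infty)$ with $|1/p(x)-1/p(y)|\le C/\log(e+1/d(x,y))$ for all $x,y\in X$. $\mu$ is lower Ahlfors $Q(\cdot)$-regular if there is $b_1\in(0,\infty)$ such that $\mu(B(x,r))\ge b_1r^{Q(x)}$ for all $x\in X$, $r\in(0,1]$. Isometries: $\mathrm{Iso}_\mu(X,d)$ is the group of isometries $\varphi$ of $(X,d)$ (onto itself) with $\varphi_\#\mu=\mu$, where $\varphi_\#\mu(A)=\mu(\varphi^{-1}(A))$ for Borel $A$. For $H\subseteq\mathrm{Iso}_\mu(X,d)$, $H(x)=\{h(x):h\in H\}$ and $M_H(x,r)=\sup\{\#A: A\subseteq H(x),\ B(\xi,r)\cap B(\eta,r)=\emptyset\text{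 for all distinct }\xi,\eta\in A\}$. $\mathcal{P}_H(X)=\{p\in\mathcal{P}(X):p\circ\varphi=p\ \text{for all }\varphi\in H\}$. The infimum over the empty set is $+\infty$. Lebesgue spaces: for $p\in\mathcal{P}_b(X)$ let $\rho_{p(\cdot)}(u)=\int_X|u(x)|^{p(x)}\,d\mu(x)$. $L^{p(\cdot)}(X,\mu)$ is the space of measurable $u$ with $\rho_{p(\cdot)}(\lambda u)<\infty$ for some $\lambda>0$, with quasi-norm $\|u\|_{L^{p(\cdot)}}=\inf\{\lambda>0:\rho_{p(\cdot)}(u/\lambda)\le1\}$. Hajłasz–Sobolev space: let $s\in\mathcal{P}_b(X)$ and $u:X\to\overline{\mathbb{R}}$ be measurable and finite a.e. A non-negative measurable function $g$ is a scalar $s(\cdot)$-gradient of $u$ (written $g\in\mathcal{D}^{s(\cdot)}(u)$) if there is a $\mu$-null set $N_u$ such that $|u(x)-u(y)|\le d(x,y)^{s(x)}g(x)+d(x,y)^{s(y)}g(y)$ for all $x,y\in X\setminus N_u$. $M^{s(\cdot),p(\cdot)}(X,d,\mu)$ is the space of $u\in L^{p(\cdot)}(X,\mu)$ with $\|u\|_{\dot M^{s(\cdot),p(\cdot)}}:=\inf_{g\in\mathcal{D}^{s(\cdot)}(u)}\|g\|_{L^{p(\cdot)}}<\infty$, with quasi-norm $\|u\|_{L^{p(\cdot)}}+\|u\|_{\dot M^{s(\cdot),p(\cdot)}}$. $M_H^{s(\cdot),p(\cdot)}(X,d,\mu)$ is its subspace of $u$ with $u\circ\varphi=u$ for all $\varphi\in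 H$. $Y\hookrightarrow\hookrightarrow Z$ (compact embedding) means $Y\subseteq Z$ with continuous inclusion mapping bounded subsets of $Y$ to totally bounded subsets of $Z$. *)

theory Defs
  imports "HOL-Analysis.Analysis" "HOL-Probability.Essential_Supremum"
begin

text \<open>The space \<open>X\<close> is the carrier of a type of class \<open>metric_space\<close>, with a measure on its Borel
  sets. Elements of the function spaces below are a.e.-classes of functions that are finite
  a.e.; they are represented by real-valued Borel functions, and two representatives of one class
  are at quasi-norm distance \<open>0\<close>.\<close>

definition metric_measure_space :: "'a::metric_space measure \<Rightarrow> bool" where
  "metric_measure_space \<mu> \<longleftrightarrow> sets \<mu> = sets borel \<and>
     (\<forall>x. \<forall>r>0. 0 < emeasure \<mu> (ball x r) \<and> emeasure \<mu> (ball x r) < \<infinity>)"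

definition geometrically_doubling :: "'a::metric_space itself \<Rightarrow> bool" where
  "geometrically_doubling _ \<longleftrightarrow> (\<exists>M::nat. \<forall>(x::'a). \<forall>r>0.
     \<exists>C. finite C \<and> card C \<le> M \<and> ball x r \<subseteq> (\<Union>c\<in>C. ball c (r / 2)))"

subsection \<open>Variable exponents\<close>

definition essinf :: "'a measure \<Rightarrow> ('a \<Rightarrow> ereal) \<Rightarrow> ereal" where
  "essinf M f = Sup {z. AE x in M. z \<le> f x}"

definition exponents :: "'a measure \<Rightarrow> ('a \<Rightarrow> ereal) set" where
  "exponents \<mu> = {p \<in> borel_measurable \<mu>. (\<forall>x. 0 < p x) \<and> 0 < essinf \<mu> p}"

text \<open>A bounded exponent may still take the value \<open>\<infinity>\<close> on a null set.\<close>

definition bounded_exponents :: "'a measure \<Rightarrow> ('a \<Rightarrow> ereal) set" where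
  "bounded_exponents \<mu> = {p \<in> exponents \<mu>. esssup \<mu> (\<lambda>x. \<bar>p x\<bar>) < \<infinity>}"

definition exponent_much_less :: "'a measure \<Rightarrow> ('a \<Rightarrow> ereal) \<Rightarrow> ('a \<Rightarrow> ereal) \<Rightarrow> bool" where
  "exponent_much_less \<mu> p1 p2 \<longleftrightarrow> 0 < essinf \<mu> (\<lambda>x. p2 x - p1 x)"

text \<open>At \<open>x = y\<close> the condition below reads \<open>0 \<le> C\<close>, because \<open>1 / 0 = 0\<close> in \<^typ>\<open>real\<close>. On a
  metric measure space, exponents in this set are finite everywhere: \<open>1 / p\<close> is continuous and
  bounded below by a positive constant a.e., and complements of null sets are dense.\<close>

definition log_exponents :: "'a::metric_space measure \<Rightarrow> ('a \<Rightarrow> ereal) set" where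
  "log_exponents \<mu> = {p \<in> bounded_exponents \<mu>. \<exists>C>0. \<forall>x y.
     \<bar>1 / p x - 1 / p y\<bar> \<le> ereal (C / ln (exp 1 + 1 / dist x y))}"

text \<open>Only used for \<open>Q\<close> finite everywhere (see above), as \<open>real_of_ereal \<infinity> = 0\<close>.\<close>

definition lower_Ahlfors_regular :: "'a::metric_space measure \<Rightarrow> ('a \<Rightarrow> ereal) \<Rightarrow> bool" where
  "lower_Ahlfors_regular \<mu> Q \<longleftrightarrow> (\<exists>b>0. \<forall>x. \<forall>r\<in>{0<..1}.
     ennreal (b * r powr real_of_ereal (Q x)) \<le> emeasure \<mu> (ball x r))"

subsection \<open>Measure-preserving isometries\<close>

definition Iso :: "'a::metric_space measure \<Rightarrow> ('a \<Rightarrow> 'a) set" where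
  "Iso \<mu> = {\<phi>. (\<forall>x y. dist (\<phi> x) (\<phi> y) = dist x y) \<and> surj \<phi> \<and> distr \<mu> \<mu> \<phi> = \<mu>}"

definition orbit_of :: "('a \<Rightarrow> 'a) set \<Rightarrow> 'a \<Rightarrow> 'a set" where
  "orbit_of H x = {h x |h. h \<in> H}"

definition orbit_packing :: "('a::metric_space \<Rightarrow> 'a) set \<Rightarrow> 'a \<Rightarrow> real \<Rightarrow> enat" where
  "orbit_packing H x r =
     (SUP A\<in>{A. A \<subseteq> orbit_of H x \<and> (\<forall>\<xi>\<in>A. \<forall>\<eta>\<in>A. \<xi> \<noteq> \<eta> \<longrightarrow> ball \<xi> r \<inter> ball \<eta> r = {})}.
        if finite A then enat (card A) else \<infinity>)"

definition invariant_exponents ::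
    "'a measure \<Rightarrow> ('a \<Rightarrow> 'a) set \<Rightarrow> ('a \<Rightarrow> ereal) set" where
  "invariant_exponents \<mu> H = {p \<in> exponents \<mu>. \<forall>\<phi>\<in>H. p \<circ> \<phi> = p}"

subsection \<open>Function spaces\<close>

text \<open>For a bounded exponent the null set where \<open>p x = \<infinity>\<close> does not affect the integral.
  Quasi-norms take values in \<^typ>\<open>ennreal\<close>, so that the infimum of the empty set is \<open>\<infinity>\<close>.\<close>

definition modular :: "'a measure \<Rightarrow> ('a \<Rightarrow> ereal) \<Rightarrow> ('a \<Rightarrow> real) \<Rightarrow> ennreal" where
  "modular \<mu> p u = (\<integral>\<^sup>+ x. ennreal (\<bar>u x\<bar> powr real_of_ereal (p x)) \<partial>\<mu>)"

definition Lebesgue_space :: "'a measure \<Rightarrow> ('a \<Rightarrow> ereal) \<Rightarrow> ('a \<Rightarrow> real) set" where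
  "Lebesgue_space \<mu> p =
     {u \<in> borel_measurable \<mu>. \<exists>l>0. modular \<mu> p (\<lambda>x. l * u x) < \<infinity>}"

definition Lebesgue_norm :: "'a measure \<Rightarrow> ('a \<Rightarrow> ereal) \<Rightarrow> ('a \<Rightarrow> real) \<Rightarrow> ennreal" where
  "Lebesgue_norm \<mu> p u = (INF l\<in>{l. 0 < l \<and> modular \<mu> p (\<lambda>x. u x / l) \<le> 1}. ennreal l)"

definition scalar_gradients ::
    "'a::metric_space measure \<Rightarrow> ('a \<Rightarrow> ereal) \<Rightarrow> ('a \<Rightarrow> real) \<Rightarrow> ('a \<Rightarrow> real) set" where
  "scalar_gradients \<mu> s u = {g \<in> borel_measurable \<mu>. (\<forall>x. 0 \<le> g x) \<and>
     (\<exists>N\<in>null_sets \<mu>. \<forall>x\<in>-N. \<forall>y\<in>-N.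
        \<bar>u x - u y\<bar> \<le> dist x y powr real_of_ereal (s x) * g x
                     + dist x y powr real_of_ereal (s y) * g y)}"

definition Sobolev_seminorm ::
    "'a::metric_space measure \<Rightarrow> ('a \<Rightarrow> ereal) \<Rightarrow> ('a \<Rightarrow> ereal) \<Rightarrow> ('a \<Rightarrow> real) \<Rightarrow> ennreal" where
  "Sobolev_seminorm \<mu> s p u = (INF g\<in>scalar_gradients \<mu> s u. Lebesgue_norm \<mu> p g)"

definition Sobolev_space ::
    "'a::metric_space measure \<Rightarrow> ('a \<Rightarrow> ereal) \<Rightarrow> ('a \<Rightarrow> ereal) \<Rightarrow> ('a \<Rightarrow> real) set" where
  "Sobolev_space \<mu> s p = {u \<in> Lebesgue_space \<mu> p. Sobolev_seminorm \<mu> s p u < \<infinity>}"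

definition Sobolev_norm ::
    "'a::metric_space measure \<Rightarrow> ('a \<Rightarrow> ereal) \<Rightarrow> ('a \<Rightarrow> ereal) \<Rightarrow> ('a \<Rightarrow> real) \<Rightarrow> ennreal" where
  "Sobolev_norm \<mu> s p u = Lebesgue_norm \<mu> p u + Sobolev_seminorm \<mu> s p u"

text \<open>Invariance is equality of a.e.-classes.\<close>

definition invariant_Sobolev_space ::
    "'a::metric_space measure \<Rightarrow> ('a \<Rightarrow> 'a) set \<Rightarrow> ('a \<Rightarrow> ereal) \<Rightarrow> ('a \<Rightarrow> ereal)
       \<Rightarrow> ('a \<Rightarrow> real) set" where
  "invariant_Sobolev_space \<mu> H s p =
     {u \<in> Sobolev_space \<mu> s p. \<forall>\<phi>\<in>H. AE x in \<mu>. (u \<circ> \<phi>) x = u x}"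

subsection \<open>Compact embeddings\<close>

definition norm_bounded :: "(('a \<Rightarrow> real) \<Rightarrow> ennreal) \<Rightarrow> ('a \<Rightarrow> real) set \<Rightarrow> bool" where
  "norm_bounded n F \<longleftrightarrow> (\<exists>C<\<infinity>. \<forall>u\<in>F. n u \<le> C)"

definition norm_totally_bounded :: "(('a \<Rightarrow> real) \<Rightarrow> ennreal) \<Rightarrow> ('a \<Rightarrow> real) set \<Rightarrow> bool" where
  "norm_totally_bounded n F \<longleftrightarrow>
     (\<forall>\<epsilon>>0. \<exists>K. finite K \<and> K \<subseteq> F \<and> (\<forall>u\<in>F. \<exists>v\<in>K. n (\<lambda>x. u x - v x) < \<epsilon>))"

definition continuous_inclusion ::
    "('a \<Rightarrow> real) set \<Rightarrow> (('a \<Rightarrow> real) \<Rightarrow> ennreal) \<Rightarrow> (('a \<Rightarrow> real) \<Rightarrow> ennreal) \<Rightarrow> bool" where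
  "continuous_inclusion Y nY nZ \<longleftrightarrow> (\<forall>u\<in>Y. \<forall>\<epsilon>>0. \<exists>\<delta>>0. \<forall>v\<in>Y.
     nY (\<lambda>x. v x - u x) < \<delta> \<longrightarrow> nZ (\<lambda>x. v x - u x) < \<epsilon>)"

definition compactly_embedded ::
    "('a \<Rightarrow> real) set \<Rightarrow> (('a \<Rightarrow> real) \<Rightarrow> ennreal)
       \<Rightarrow> ('a \<Rightarrow> real) set \<Rightarrow> (('a \<Rightarrow> real) \<Rightarrow> ennreal) \<Rightarrow> bool" where
  "compactly_embedded Y nY Z nZ \<longleftrightarrow> Y \<subseteq> Z \<and> continuous_inclusion Y nY nZ \<and>
     (\<forall>F\<subseteq>Y. norm_bounded nY F \<longrightarrow> norm_totally_bounded nZ F)"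

end

theory Submission
  imports Defs
begin

text \<open>
  A bounded family in \<open>M\<^sup>s\<^sup>,\<^sup>p\<close> could fail to be precompact in \<open>L\<^sup>q\<close> by concentrating, by oscillating or
  by escaping to infinity. One estimate deals with all three,
  \<open>small_modular_of_small_in_measure\<close>: if \<open>w\<close> and a gradient \<open>g\<close> of \<open>w\<close> have \<open>p\<close>-modulars at most
  \<open>C\<close>, and if \<open>{\<bar>w\<bar> > \<eta>}\<close> has measure at most \<open>\<sigma>\<close> in every ball of one fixed radius, then the
  \<open>q\<close>-modular of \<open>w\<close> is as small as desired, with \<open>\<eta>\<close> and \<open>\<sigma>\<close> independent of \<open>w\<close> and \<open>g\<close>.

  The estimate comes from pointwise bounds for \<open>\<bar>w(x)\<bar>\<^sup>q\<^sup>(\<^sup>x\<^sup>)\<close> in three ranges of \<open>\<bar>w(x)\<bar>\<close>.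
  Small values (\<open>low_bound\<close>) use only \<open>q \<ge> p + c\<close>. For large values (\<open>pointwise_bound\<close>,
  \<open>high_bound\<close>), one joins \<open>x\<close> to a point with \<open>\<bar>w\<bar> \<le> 1\<close> through points of \<open>B(x,t)\<close>, \<open>B(x,2t)\<close>,
  \<open>B(x,4t)\<close>, ... at which \<open>g\<^sup>p\<close> is at most a multiple of the radius to the power \<open>-Q\<close>. Lower regularity and log-Hoelder continuity turn the
  gradient inequality into a geometric series, and \<open>\<bar>w(x)\<bar> \<le> K (t\<^sup>s g(x) + t\<^sup>s\<^sup>-\<^sup>Q\<^sup>/\<^sup>p)\<close>; the best \<open>t\<close> gives
  \<open>\<bar>w\<bar>\<^sup>\<gamma> \<le> K g\<^sup>p\<close> wherever \<open>g \<ge> 1\<close>, with the critical exponent \<open>\<gamma> = Qp/(Q - sp)\<close>, and \<open>q \<le> \<gamma> - c\<close> leaves a small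
  factor. For intermediate values (\<open>middle_bound\<close>), \<open>\<bar>w(x)\<bar>\<close> is comparable to its difference from the value at a
  nearby \<open>y\<close> with \<open>\<bar>w(y)\<bar> \<le> \<eta>\<close>, which is controlled by \<open>t\<^sup>s g(x)\<close> and the integral of \<open>g\<^sup>p\<close> over
  \<open>B(x,t)\<close>; by Tonelli, the latter has a small integral over \<open>{\<bar>w\<bar> > \<eta>}\<close>. No averages of \<open>w\<close> occur, so that
  exponents below \<open>1\<close> need no separate treatment.

  Smallness in measure is obtained as follows. If the norm of \<open>w\<close> is small, Chebyshev's inequality gives it;
  this yields the inclusion and its continuity (\<open>unit_ball_embedding\<close>). For differences of members of a
  bounded invariant family, balls far from \<open>x\<^sub>0\<close> have many disjoint copies carrying the same integral of
  \<open>\<bar>w\<bar>\<^sup>p\<close> (\<open>symmetric_decay\<close>). Near \<open>x\<^sub>0\<close>, outside a set of small measure, members of the family are bounded and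
  have small oscillation on tiny balls, so rounding their values at one point per ball splits the family into finitely
  many classes of functions that are close in measure (\<open>finite_classes_in_measure\<close>).
\<close>

section \<open>Elementary inequalities\<close>

lemma powr_le_exp_mult_powr:
  fixes t a a' K :: real
  assumes "0 < t" "t \<le> 1" "\<bar>a - a'\<bar> * ln (1 / t) \<le> K"
  shows "t powr a' \<le> exp K * t powr a"
proof -
  have "(a' - a) * ln t \<le> \<bar>a - a'\<bar> * ln (1 / t)"
  proof -
    have "ln (1/t) = - ln t" using assms by (simp add: ln_div)
    moreover have "ln t \<le> 0" using assms by simp
    moreover have "(a' - a) * ln t = (a - a') * (- ln t)" by (simp add: algebra_simps)
    ultimately show ?thesis by (metis abs_ge_self mult_right_mono neg_0_le_iff_le)
  qed
  hence "(a' - a) * ln t \<le> K" using assms by linarith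
  hence "exp (a' * ln t) \<le> exp (K + a * ln t)" by (simp add: algebra_simps)
  thus ?thesis using assms by (simp add: powr_def exp_add)
qed

lemma log_modulus_mult_ln_le:
  fixes d t C :: real
  assumes "0 < d" "d < t" "t \<le> 1" "0 \<le> C"
  shows "C / ln (exp 1 + 1 / d) * ln (1 / t) \<le> C"
proof -
  have "1 / t \<le> exp 1 + 1 / d"
    using assms frac_le[of 1 1 d t] exp_gt_zero[of "1::real"] by linarith
  hence 1: "ln (1 / t) \<le> ln (exp 1 + 1 / d)" using assms by (intro ln_mono) auto
  have "ln (exp 1) \<le> ln (exp 1 + 1 / d)" using assms by (subst ln_le_cancel_iff) (auto intro: add_pos_pos)
  hence 2: "0 < ln (exp 1 + 1 / d)" by simp
  have "C * ln (1 / t) \<le> C * ln (exp 1 + 1 / d)" using 1 assms by (intro mult_left_mono)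
  thus ?thesis using 2 by (simp add: field_simps)
qed

text \<open>The logarithm in the modulus of continuity cancels \<open>ln (1/t)\<close> at distances below \<open>t\<close>. Combined with \<open>powr_le_exp_mult_powr\<close>, this allows exponents at nearby points to be exchanged in powers of the radius, up to a bounded factor.
  An upper bound of \<open>p\<close> transfers the estimate from \<open>1/p\<close> to \<open>p\<close>.\<close>

lemma log_Hoelder_oscillation:
  fixes p p' M L d t :: real
  assumes p: "0 < p" "p \<le> M" and p': "0 < p'" "p' \<le> M" and L: "0 \<le> L"
    and d: "0 \<le> d" "d < t" "t \<le> 1" "d = 0 \<Longrightarrow> p = p'"
    and log: "\<bar>1 / p - 1 / p'\<bar> \<le> L / ln (exp 1 + 1 / d)"
  shows "\<bar>1 / p - 1 / p'\<bar> * ln (1 / t) \<le> L" "\<bar>p - p'\<bar> * ln (1 / t) \<le> M\<^sup>2 * L"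
proof -
  have ln: "0 \<le> ln (1 / t)" using d by simp
  show *: "\<bar>1 / p - 1 / p'\<bar> * ln (1 / t) \<le> L"
  proof (cases "d = 0")
    case True thus ?thesis using d(4) L by simp
  next
    case False
    have "\<bar>1 / p - 1 / p'\<bar> * ln (1 / t) \<le> L / ln (exp 1 + 1 / d) * ln (1 / t)"
      using log ln by (rule mult_right_mono)
    also have "\<dots> \<le> L" using False d L by (intro log_modulus_mult_ln_le) auto
    finally show ?thesis .
  qed
  have "p' - p = p * p' * (1 / p - 1 / p')" using p p' by (simp add: field_simps)
  hence "\<bar>p' - p\<bar> = \<bar>p * p'\<bar> * \<bar>1 / p - 1 / p'\<bar>" by (simp only: abs_mult)
  hence "\<bar>p - p'\<bar> * ln (1 / t) = p * p' * (\<bar>1 / p - 1 / p'\<bar> * ln (1 / t))"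
    using p p' by (simp add: abs_minus_commute abs_mult)
  also have "\<dots> \<le> (M * M) * L"
    using p p' * ln by (intro mult_mono) (auto intro: less_imp_le mult_nonneg_nonneg)
  finally show "\<bar>p - p'\<bar> * ln (1 / t) \<le> M\<^sup>2 * L" by (simp add: power2_eq_square)
qed

lemma small_powr:
  fixes a C \<delta> :: real
  assumes "0 < a" "0 < \<delta>" "0 \<le> C"
  shows "\<exists>h. 0 < h \<and> h \<le> 1 \<and> (\<forall>h'. 0 \<le> h' \<longrightarrow> h' \<le> h \<longrightarrow> h' powr a * C \<le> \<delta>)"
proof -
  define h where "h = min 1 ((\<delta> / (C + 1)) powr (1 / a))"
  have h: "0 < h" "h \<le> 1" using assms by (auto simp: h_def)
  have "h' powr a * C \<le> \<delta>" if "0 \<le> h'" "h' \<le> h" for h'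
  proof -
    have "h' powr a \<le> ((\<delta> / (C + 1)) powr (1 / a)) powr a"
      using that assms by (intro powr_mono2) (auto simp: h_def)
    also have "\<dots> = \<delta> / (C + 1)" using assms by (simp add: powr_powr)
    finally have "h' powr a * C \<le> \<delta> / (C + 1) * C" using assms by (intro mult_right_mono) auto
    also have "\<dots> \<le> \<delta>" using assms by (simp add: field_simps)
    finally show ?thesis .
  qed
  with h show ?thesis by blast
qed

lemma floor_divide_eq_imp_close:
  fixes a b \<delta> :: real
  assumes "0 < \<delta>" "\<lfloor>a / \<delta>\<rfloor> = \<lfloor>b / \<delta>\<rfloor>"
  shows "\<bar>a - b\<bar> < \<delta>"
proof -
  have "\<bar>a / \<delta> - b / \<delta>\<bar> < 1" using assms(2) by linarith
  hence "\<bar>a - b\<bar> / \<delta> < 1" using assms(1) by (simp add: abs_divide flip: diff_divide_distrib)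
  thus ?thesis using assms(1) by (simp add: pos_divide_less_eq)
qed

lemma abs_diff_less_of_close:
  fixes x y a b d e :: real
  assumes "\<bar>x - a\<bar> \<le> e" "\<bar>a - b\<bar> < d" "\<bar>y - b\<bar> \<le> e"
  shows "\<bar>x - y\<bar> < 2 * e + d"
  using assms unfolding abs_le_iff abs_less_iff by linarith

section \<open>Points below the mean, and separability of doubling spaces\<close>

text \<open>Otherwise \<open>f\<close> would exceed the quotient of its integral by \<open>m\<close> almost everywhere on \<open>A\<close>, and its integral
  would be strictly larger than itself. The case of a vanishing integral is
  why a crude Chebyshev bound is not enough.\<close>

lemma exists_point_below_mean:
  fixes f :: "'a \<Rightarrow> ennreal"
  assumes A: "A \<in> sets M" and f: "f \<in> borel_measurable M"
    and m: "m \<le> emeasure M A" "0 < m" and fin: "emeasure M A < \<infinity>" and N: "N \<in> null_sets M"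
  shows "\<exists>y\<in>A - N. f y * m \<le> (\<integral>\<^sup>+x\<in>A. f x \<partial>M)"
proof (rule ccontr)
  define I where "I = (\<integral>\<^sup>+x\<in>A. f x \<partial>M)"
  assume "\<not> ?thesis"
  hence less: "I < f y * m" if "y \<in> A - N" for y using that by (auto simp: I_def not_le)
  have "emeasure M (A - N) = emeasure M A" using N A by (simp add: emeasure_Diff_null_set)
  hence "A - N \<noteq> {}" using m by force
  then obtain y where y: "y \<in> A - N" by blast
  have I: "I < \<infinity>" using order.strict_trans2[OF less[OF y] top_greatest] by simp
  have m_fin: "m < \<infinity>" using m fin by (rule_tac order.strict_trans1)
  have m_ne: "m \<noteq> 0" "m \<noteq> \<infinity>" using m m_fin by auto
  have lt: "I / m < f x" if "x \<in> A - N" for x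
    using less[OF that] m_ne m_fin by (simp add: divide_less_ennreal m(2))
  have "(\<integral>\<^sup>+x. (I / m) * indicator A x \<partial>M) < (\<integral>\<^sup>+x. f x * indicator A x \<partial>M)"
  proof (rule nn_integral_less)
    show "(\<integral>\<^sup>+x. (I / m) * indicator A x \<partial>M) \<noteq> \<infinity>"
      using A I m_ne fin
      by (subst nn_integral_cmult_indicator)
         (auto simp: ennreal_mult_eq_top_iff ennreal_divide_eq_top_iff)
    show "AE x in M. (I / m) * indicator A x \<le> f x * indicator A x"
      using AE_not_in[OF N] by eventually_elim (use lt in \<open>auto simp: indicator_def less_imp_le\<close>)
    show "\<not> (AE x in M. f x * indicator A x \<le> (I / m) * indicator A x)"
    proof
      assume "AE x in M. f x * indicator A x \<le> (I / m) * indicator A x"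
      hence "AE x in M. x \<notin> A" using AE_not_in[OF N]
        by eventually_elim (use lt in \<open>auto simp: indicator_def not_le[symmetric]\<close>)
      hence "emeasure M A = 0" using A by (simp add: AE_iff_null_sets null_setsD1)
      thus False using m by auto
    qed
  qed (use A f in auto)
  moreover have "I \<le> (\<integral>\<^sup>+x. (I / m) * indicator A x \<partial>M)"
  proof -
    have "I = I / m * m" using m_ne by (simp only: ennreal_divide_times ennreal_times_divide mult_divide_eq_ennreal infinity_ennreal_def not_False_eq_True)
    also have "\<dots> \<le> I / m * emeasure M A" using m by (intro mult_left_mono) auto
    finally show ?thesis using A by (simp add: nn_integral_cmult_indicator)
  qed
  ultimately show False by (simp add: I_def)
qed

lemma doubling_finite_cover_power:
  fixes x :: "'a::metric_space"
  assumes "geometrically_doubling TYPE('a)" "0 < R"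
  shows "\<exists>C. finite C \<and> ball x R \<subseteq> (\<Union>c\<in>C. ball c (R / 2 ^ n))"
proof (induction n)
  case 0
  show ?case by (intro exI[of _ "{x}"]) auto
next
  case (Suc n)
  then obtain C where C: "finite C" "ball x R \<subseteq> (\<Union>c\<in>C. ball c (R / 2 ^ n))" by blast
  obtain M :: nat where M: "\<And>(x::'a) r. r > 0 \<Longrightarrow> \<exists>C. finite C \<and> card C \<le> M \<and> ball x r \<subseteq> (\<Union>c\<in>C. ball c (r / 2))"
    using assms(1) by (auto simp: geometrically_doubling_def)
  have "\<forall>c::'a. \<exists>D. finite D \<and> ball c (R / 2 ^ n) \<subseteq> (\<Union>d\<in>D. ball d (R / 2 ^ Suc n))"
  proof
    fix c :: 'a
    show "\<exists>D. finite D \<and> ball c (R / 2 ^ n) \<subseteq> (\<Union>d\<in>D. ball d (R / 2 ^ Suc n))"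
      using M[of "R / 2 ^ n" c] assms(2) by (auto simp: mult.commute)
  qed
  then obtain D where D: "\<And>c::'a. finite (D c)" "\<And>c::'a. ball c (R / 2 ^ n) \<subseteq> (\<Union>d\<in>D c. ball d (R / 2 ^ Suc n))"
    by metis
  show ?case
  proof (intro exI conjI)
    show "finite (\<Union>c\<in>C. D c)" using C D by blast
    show "ball x R \<subseteq> (\<Union>c\<in>(\<Union>c\<in>C. D c). ball c (R / 2 ^ Suc n))"
    proof
      fix z assume "z \<in> ball x R"
      then obtain c where c: "c \<in> C" "z \<in> ball c (R / 2 ^ n)" using C(2) by blast
      then obtain d where "d \<in> D c" "z \<in> ball d (R / 2 ^ Suc n)" using D(2) by blast
      with c(1) show "z \<in> (\<Union>c\<in>(\<Union>c\<in>C. D c). ball c (R / 2 ^ Suc n))"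
        by (intro UN_I[of d] UN_I[of c])
    qed
  qed
qed

lemma doubling_finite_cover:
  fixes x :: "'a::metric_space"
  assumes "geometrically_doubling TYPE('a)" "0 < \<tau>"
  shows "\<exists>C. finite C \<and> ball x R \<subseteq> (\<Union>c\<in>C. ball c \<tau>)"
proof (cases "R > 0")
  case True
  obtain n where "R / \<tau> < 2 ^ n" using real_arch_pow[of 2 "R / \<tau>"] by auto
  hence n: "R / 2 ^ n < \<tau>" using assms(2) by (simp add: field_simps)
  obtain C where C: "finite C" "ball x R \<subseteq> (\<Union>c\<in>C. ball c (R / 2 ^ n))"
    using doubling_finite_cover_power[OF assms(1) True] by blast
  have "ball c (R / 2 ^ n) \<subseteq> ball c \<tau>" for c using n by (intro subset_ball) auto
  with C show ?thesis by (intro exI[of _ C]) blast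
next
  case False
  thus ?thesis by (intro exI[of _ "{}"]) auto
qed

text \<open>Centres of finite covers of the balls around one point by balls of radius \<open>1/(n+1)\<close>.\<close>

lemma doubling_countable_dense:
  assumes "geometrically_doubling TYPE('a::metric_space)"
  shows "\<exists>D::'a set. countable D \<and> (\<forall>x. \<forall>e>0. \<exists>z\<in>D. dist x z < e)"
proof -
  fix x0 :: 'a
  have "\<forall>m n::nat. \<exists>C. finite C \<and> ball x0 (real m) \<subseteq> (\<Union>c\<in>C. ball c (inverse (real (Suc n))))"
    using doubling_finite_cover[OF assms] by simp
  then obtain C where C: "\<And>m n. finite (C m n)"
      "\<And>m n. ball x0 (real m) \<subseteq> (\<Union>c\<in>C m n. ball c (inverse (real (Suc n))))" by metis
  show ?thesis
  proof (intro exI[of _ "\<Union>m n. C m n"] conjI allI impI)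
    show "countable (\<Union>m n. C m n)" using C(1) by (intro countable_UN) (auto intro: countable_finite)
  next
    fix x :: 'a and e :: real assume "e > 0"
    then obtain n where n: "inverse (real (Suc n)) < e" using reals_Archimedean by blast
    obtain m :: nat where "dist x0 x < m" using reals_Archimedean2 by blast
    with C(2)[of m n] obtain c where "c \<in> C m n" "dist c x < inverse (real (Suc n))" by auto
    with n show "\<exists>z\<in>(\<Union>m n. C m n). dist x z < e" by (intro bexI[of _ c]) (auto simp: dist_commute)
  qed
qed

text \<open>In a space that is not second countable, the product of the Borel algebras may be smaller than
  the Borel algebra of the product; separability makes a neighbourhood of the diagonal a countable
  union of products of balls.\<close>

lemma sets_pair_dist_less:
  fixes D :: "'a::metric_space set"
  assumes D: "countable D" "\<And>x e. e > 0 \<Longrightarrow> \<exists>z\<in>D. dist x z < e"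
    and M: "sets M = sets (borel :: 'a measure)"
  shows "{(x :: 'a, y). dist x y < t} \<in> sets (M \<Otimes>\<^sub>M M)"
proof -
  have "{(x, y). dist x y < t} = (\<Union>z\<in>D. \<Union>a\<in>\<rat>. ball z a \<times> ball z (t - a))"
  proof (intro set_eqI iffI)
    fix w :: "'a \<times> 'a" assume "w \<in> (\<Union>z\<in>D. \<Union>a\<in>\<rat>. ball z a \<times> ball z (t - a))"
    then obtain x y z a where w: "w = (x, y)" "dist z x < a" "dist z y < t - a" by auto
    have "dist x y \<le> dist z x + dist z y" by (simp add: dist_triangle3)
    thus "w \<in> {(x, y). dist x y < t}" using w by simp
  next
    fix w :: "'a \<times> 'a" assume "w \<in> {(x, y). dist x y < t}"
    then obtain x y where w: "w = (x, y)" "dist x y < t" by auto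
    then obtain z where z: "z \<in> D" "dist x z < (t - dist x y) / 2" using D(2)[of "(t - dist x y) / 2" x] by auto
    have "dist x z < t - dist x y - dist x z" using z by (simp add: field_simps)
    then obtain a where a: "a \<in> \<rat>" "dist x z < a" "a < t - dist x y - dist x z" using Rats_dense_in_real by blast
    have "dist z y \<le> dist x z + dist x y" by (metis dist_commute dist_triangle3 add.commute dist_triangle)
    hence "w \<in> ball z a \<times> ball z (t - a)" using w a by (auto simp: dist_commute)
    thus "w \<in> (\<Union>z\<in>D. \<Union>a\<in>\<rat>. ball z a \<times> ball z (t - a))" using z a by blast
  qed
  also have "\<dots> \<in> sets (M \<Otimes>\<^sub>M M)"
    using D(1) countable_rat M by (intro sets.countable_UN' pair_measureI) auto
  finally show ?thesis .
qed

section \<open>Fractional gradients and the standing assumptions\<close>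

text \<open>The gradient inequality for real exponents, with its exceptional set as a parameter, so that it can be enlarged and
  combined for differences.\<close>

definition gradient_off ::
    "('a \<Rightarrow> real) \<Rightarrow> ('a::metric_space \<Rightarrow> real) \<Rightarrow> ('a \<Rightarrow> real) \<Rightarrow> 'a set \<Rightarrow> bool" where
  "gradient_off S u g N \<longleftrightarrow> (\<forall>x. 0 \<le> g x) \<and>
     (\<forall>x\<in>-N. \<forall>y\<in>-N. \<bar>u x - u y\<bar> \<le> dist x y powr S x * g x + dist x y powr S y * g y)"

lemma gradient_off_scale:
  assumes "gradient_off S u g N" "0 \<le> k"
  shows "gradient_off S (\<lambda>x. k * u x) (\<lambda>x. k * g x) N"
  unfolding gradient_off_def
proof (intro conjI allI ballI)
  fix x y assume "x \<in> - N" "y \<in> - N"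
  hence "\<bar>u x - u y\<bar> \<le> dist x y powr S x * g x + dist x y powr S y * g y"
    using assms(1) unfolding gradient_off_def by blast
  hence "k * \<bar>u x - u y\<bar> \<le> k * (dist x y powr S x * g x + dist x y powr S y * g y)"
    using assms(2) by (rule mult_left_mono)
  moreover have "\<bar>k * u x - k * u y\<bar> = k * \<bar>u x - u y\<bar>"
    using assms(2) by (simp add: abs_mult flip: right_diff_distrib)
  ultimately show "\<bar>k * u x - k * u y\<bar> \<le> dist x y powr S x * (k * g x) + dist x y powr S y * (k * g y)"
    by (simp add: algebra_simps)
qed (use assms in \<open>auto simp: gradient_off_def\<close>)

lemma gradient_off_diff:
  assumes "gradient_off S u g N" "gradient_off S v g' N'"
  shows "gradient_off S (\<lambda>x. u x - v x) (\<lambda>x. g x + g' x) (N \<union> N')"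
  unfolding gradient_off_def
proof (intro conjI allI ballI)
  fix x y assume "x \<in> - (N \<union> N')" "y \<in> - (N \<union> N')"
  hence "\<bar>u x - u y\<bar> \<le> dist x y powr S x * g x + dist x y powr S y * g y"
    "\<bar>v x - v y\<bar> \<le> dist x y powr S x * g' x + dist x y powr S y * g' y"
    using assms unfolding gradient_off_def by blast+
  moreover have "\<bar>u x - v x - (u y - v y)\<bar> \<le> \<bar>u x - u y\<bar> + \<bar>v x - v y\<bar>" by simp
  ultimately show "\<bar>u x - v x - (u y - v y)\<bar> \<le> dist x y powr S x * (g x + g' x) + dist x y powr S y * (g y + g' y)"
    by (simp only: distrib_left)
qed (use assms in \<open>auto simp: gradient_off_def\<close>)

text \<open>The situation after discarding a null set \<open>Z\<close>: real-valued exponents with uniform bounds, and one gap \<open>c\<close> for the three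
  relations \<open>SP \<lless> Q\<close>, \<open>P \<lless> q\<close> and \<open>q \<lless> QP/(Q - SP)\<close>.\<close>

locale subcritical_exponents =
  fixes \<mu> :: "'a::metric_space measure"
    and P S Q q :: "'a \<Rightarrow> real" and Z :: "'a set"
    and pm pM sm sM QM c b L :: real
  assumes metric_measure: "metric_measure_space \<mu>"
    and doubling: "geometrically_doubling TYPE('a)"
    and Z: "Z \<in> null_sets \<mu>"
    and P_measurable [measurable]: "P \<in> borel_measurable \<mu>"
    and q_measurable [measurable]: "q \<in> borel_measurable \<mu>"
    and pos: "0 < pm" "0 < sm" "0 < c" "0 < b" "0 \<le> L"
    and lower_regular: "\<And>x t. x \<notin> Z \<Longrightarrow> 0 < t \<Longrightarrow> t \<le> 1 \<Longrightarrow>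
          ennreal (b * t powr Q x) \<le> emeasure \<mu> (ball x t)"
    and P_bounds: "\<And>x. x \<notin> Z \<Longrightarrow> pm \<le> P x" "\<And>x. x \<notin> Z \<Longrightarrow> P x \<le> pM"
    and S_bounds: "\<And>x. x \<notin> Z \<Longrightarrow> sm \<le> S x" "\<And>x. x \<notin> Z \<Longrightarrow> S x \<le> sM"
    and Q_bound: "\<And>x. x \<notin> Z \<Longrightarrow> Q x \<le> QM"
    and subcritical: "\<And>x. x \<notin> Z \<Longrightarrow> S x * P x + c \<le> Q x"
    and q_above: "\<And>x. x \<notin> Z \<Longrightarrow> P x + c \<le> q x"
    and q_below: "\<And>x. x \<notin> Z \<Longrightarrow> q x + c \<le> Q x * P x / (Q x - S x * P x)"
    and P_log: "\<And>x y. x \<notin> Z \<Longrightarrow> y \<notin> Z \<Longrightarrow>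
          \<bar>1 / P x - 1 / P y\<bar> \<le> L / ln (exp 1 + 1 / dist x y)"
    and S_log: "\<And>x y. x \<notin> Z \<Longrightarrow> y \<notin> Z \<Longrightarrow>
          \<bar>1 / S x - 1 / S y\<bar> \<le> L / ln (exp 1 + 1 / dist x y)"
begin

lemma sets_eq [measurable_cong, simp]: "sets \<mu> = sets borel"
  using metric_measure by (simp add: metric_measure_space_def)

lemma space_eq [simp]: "space \<mu> = UNIV"
  using sets_eq_imp_space_eq[OF sets_eq] by simp

lemma emeasure_ball_finite: "emeasure \<mu> (ball x t) < \<infinity>"
proof (cases "t > 0")
  case True thus ?thesis using metric_measure by (simp add: metric_measure_space_def)
next
  case False thus ?thesis by (simp add: ball_empty)
qed

lemma sigma_finite: "sigma_finite_measure \<mu>"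
proof
  fix x0 :: 'a
  have "(\<Union>n::nat. ball x0 (real n)) = UNIV"
    using reals_Archimedean2 by (auto simp: set_eq_iff)
  thus "\<exists>A. countable A \<and> A \<subseteq> sets \<mu> \<and> \<Union>A = space \<mu> \<and> (\<forall>a\<in>A. emeasure \<mu> a \<noteq> \<infinity>)"
    using emeasure_ball_finite
    by (intro exI[of _ "range (\<lambda>n::nat. ball x0 (real n))"]) (auto simp: less_le)
qed

lemma QM_pos: "0 < QM" and pM_pos: "0 < pM"
proof -
  have "space \<mu> \<notin> null_sets \<mu>"
  proof
    assume "space \<mu> \<in> null_sets \<mu>"
    hence "ball undefined 1 \<in> null_sets \<mu>" by (rule null_sets_subset) auto
    thus False using metric_measure by (auto simp: metric_measure_space_def null_sets_def less_le)
  qed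
  then obtain x where x: "x \<notin> Z" using Z by (metis UNIV_I UNIV_eq_I space_eq)
  show "0 < pM" using P_bounds[OF x] pos by auto
  have "0 < S x * P x" using P_bounds[OF x] S_bounds[OF x] pos by (intro mult_pos_pos) auto
  thus "0 < QM" using subcritical[OF x] Q_bound[OF x] pos by linarith
qed

lemma Q_pos: "x \<notin> Z \<Longrightarrow> 0 < Q x" and P_pos: "x \<notin> Z \<Longrightarrow> 0 < P x" and S_pos: "x \<notin> Z \<Longrightarrow> 0 < S x"
proof -
  assume x: "x \<notin> Z"
  show P: "0 < P x" and S: "0 < S x" using P_bounds[OF x] S_bounds[OF x] pos by auto
  show "0 < Q x" using mult_pos_pos[OF S P] subcritical[OF x] pos by linarith
qed

lemma P_osc:
  assumes "x \<notin> Z" "y \<notin> Z" "dist x y < t" "t \<le> 1"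
  shows "\<bar>1 / P x - 1 / P y\<bar> * ln (1 / t) \<le> L" "\<bar>P x - P y\<bar> * ln (1 / t) \<le> pM\<^sup>2 * L"
  using assms log_Hoelder_oscillation[OF P_pos P_bounds(2) P_pos P_bounds(2) pos(5) zero_le_dist _ _ _ P_log,
      of x y t] by auto

lemma S_osc:
  assumes "x \<notin> Z" "y \<notin> Z" "dist x y < t" "t \<le> 1"
  shows "\<bar>S x - S y\<bar> * ln (1 / t) \<le> sM\<^sup>2 * L"
  using assms log_Hoelder_oscillation(2)[OF S_pos S_bounds(2) S_pos S_bounds(2) pos(5) zero_le_dist _ _ _ S_log,
      of x y t] by auto

text \<open>At least half of the measure that lower regularity guarantees lies outside \<open>E\<close>, so the mean can be taken over
  \<open>ball x t - E\<close>. Keeping the local integral on the right-hand side matters for \<open>middle_bound\<close>.\<close>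

lemma exists_good_point:
  assumes x: "x \<notin> Z" and t: "0 < t" "t \<le> 1" and E: "E \<in> sets \<mu>" and N: "N \<in> null_sets \<mu>"
    and g: "g \<in> borel_measurable \<mu>"
    and small: "emeasure \<mu> (E \<inter> ball x t) \<le> ennreal (b / 2 * t powr Q x)"
  shows "\<exists>y. y \<in> ball x t \<and> y \<notin> E \<and> y \<notin> N \<and> y \<notin> Z \<and>
    ennreal (\<bar>g y\<bar> powr P y) * ennreal (b / 2 * t powr Q x)
      \<le> (\<integral>\<^sup>+y\<in>ball x t. ennreal (\<bar>g y\<bar> powr P y) \<partial>\<mu>)"
proof -
  define m where "m = b / 2 * t powr Q x"
  have m: "0 < m" using t pos by (simp add: m_def)
  have fin: "emeasure \<mu> (ball x t - E) < \<infinity>"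
    using E by (intro order.strict_trans1[OF emeasure_mono emeasure_ball_finite[of x t]]) auto
  have "ennreal m + ennreal m \<le> emeasure \<mu> (ball x t)"
    using lower_regular[OF x t] m by (simp add: m_def flip: ennreal_plus)
  also have "\<dots> = emeasure \<mu> (ball x t - E) + emeasure \<mu> (E \<inter> ball x t)"
  proof -
    have "ball x t = (ball x t - E) \<union> (E \<inter> ball x t)" by blast
    moreover have "emeasure \<mu> (ball x t - E) + emeasure \<mu> (E \<inter> ball x t)
        = emeasure \<mu> ((ball x t - E) \<union> (E \<inter> ball x t))"
      using E by (intro plus_emeasure) auto
    ultimately show ?thesis by simp
  qed
  also have "\<dots> \<le> emeasure \<mu> (ball x t - E) + ennreal m"
    using small unfolding m_def by (intro add_left_mono)
  finally have *: "ennreal m \<le> emeasure \<mu> (ball x t - E)" by simp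
  have "\<exists>y\<in>(ball x t - E) - (N \<union> Z). ennreal (\<bar>g y\<bar> powr P y) * ennreal m
          \<le> (\<integral>\<^sup>+y\<in>ball x t - E. ennreal (\<bar>g y\<bar> powr P y) \<partial>\<mu>)"
    using E N Z g m fin * by (intro exists_point_below_mean) auto
  then obtain y where y: "y \<in> (ball x t - E) - (N \<union> Z)" "ennreal (\<bar>g y\<bar> powr P y) * ennreal m
          \<le> (\<integral>\<^sup>+y\<in>ball x t - E. ennreal (\<bar>g y\<bar> powr P y) \<partial>\<mu>)" by blast
  note y(2)
  also have "(\<integral>\<^sup>+y\<in>ball x t - E. ennreal (\<bar>g y\<bar> powr P y) \<partial>\<mu>)
      \<le> (\<integral>\<^sup>+y\<in>ball x t. ennreal (\<bar>g y\<bar> powr P y) \<partial>\<mu>)"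
    by (intro nn_integral_mono) (auto simp: indicator_def)
  finally show ?thesis using y(1) unfolding m_def by blast
qed

section \<open>Pointwise control by chaining through good points\<close>

text \<open>With \<open>g(y)\<close> of order \<open>t\<^sup>-\<^sup>Q\<^sup>/\<^sup>P\<close>, a step of length \<open>t\<close> changes the function by a multiple of \<open>t\<close> to the power
  minus this exponent, which is positive in the subcritical range.\<close>

definition decay :: "'a \<Rightarrow> real" where "decay x = Q x / P x - S x"

lemma decay_bounds:
  assumes "x \<notin> Z" shows "c / pM \<le> decay x" "decay x \<le> QM / pm"
proof -
  have "decay x = (Q x - S x * P x) / P x" using P_pos[OF assms] by (simp add: decay_def field_simps)
  moreover have "c / pM \<le> (Q x - S x * P x) / P x"
    using subcritical[OF assms] P_pos[OF assms] P_bounds[OF assms] pos by (intro frac_le) auto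
  ultimately show "c / pM \<le> decay x" by simp
  have "Q x / P x \<le> QM / pm"
    using Q_bound[OF assms] P_bounds[OF assms] pos QM_pos by (intro frac_le) auto
  thus "decay x \<le> QM / pm" using S_pos[OF assms] by (simp add: decay_def)
qed

text \<open>\<open>K_good\<close> is the constant of \<open>good_bound\<close>. \<open>K_chain\<close> is the sum of a geometric series with ratio
  \<open>2\<^sup>-\<^sup>c\<^sup>/\<^sup>p\<^sup>M\<close>, whose terms are the steps of the chain, enlarged by \<open>1\<close> for the final point, where
  \<open>\<bar>w\<bar> \<le> 1\<close>.\<close>

definition K_good :: "real \<Rightarrow> real" where
  "K_good C = max 1 (2 * C / b) powr (1 / pm) * exp (QM * L) * exp (sM\<^sup>2 * L)"

definition K_chain :: "real \<Rightarrow> real" where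
  "K_chain C = (2 * 3 powr sM * K_good C + 1) / (1 - 2 powr (- (c / pM)))"

text \<open>When \<open>C\<close> bounds the integral of \<open>g\<^sup>P\<close>, the last condition says that \<open>g\<^sup>P\<close> at \<open>y\<close> is at most twice the largest mean that
  lower regularity permits on the ball. All powers of \<open>t\<close> use the exponent at the fixed centre \<open>x\<close>.\<close>

definition good :: "('a \<Rightarrow> real) \<Rightarrow> real \<Rightarrow> 'a \<Rightarrow> real \<Rightarrow> 'a \<Rightarrow> bool" where
  "good g C x t y \<longleftrightarrow> y \<notin> Z \<and> dist x y < t \<and> g y powr P y * (b / 2 * t powr Q x) \<le> C"

lemma exists_good:
  assumes x: "x \<notin> Z" and t: "0 < t" "t \<le> 1" and E: "E \<in> sets \<mu>" and N: "N \<in> null_sets \<mu>"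
    and g: "g \<in> borel_measurable \<mu>" "\<And>x. 0 \<le> g x"
    and small: "emeasure \<mu> (E \<inter> ball x t) \<le> ennreal (b / 2 * t powr Q x)"
    and C: "(\<integral>\<^sup>+y. ennreal (\<bar>g y\<bar> powr P y) \<partial>\<mu>) \<le> ennreal C" "0 \<le> C"
  shows "\<exists>y. good g C x t y \<and> y \<notin> E \<and> y \<notin> N"
proof -
  obtain y where y: "y \<in> ball x t" "y \<notin> E" "y \<notin> N" "y \<notin> Z" and le:
    "ennreal (\<bar>g y\<bar> powr P y) * ennreal (b / 2 * t powr Q x)
      \<le> (\<integral>\<^sup>+y\<in>ball x t. ennreal (\<bar>g y\<bar> powr P y) \<partial>\<mu>)"
    using exists_good_point[OF x t E N g(1) small] by blast
  note le
  also have "(\<integral>\<^sup>+y\<in>ball x t. ennreal (\<bar>g y\<bar> powr P y) \<partial>\<mu>) \<le> (\<integral>\<^sup>+y. ennreal (\<bar>g y\<bar> powr P y) \<partial>\<mu>)"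
    by (intro nn_integral_mono) (auto simp: indicator_def)
  also note C(1)
  finally have "ennreal (g y powr P y * (b / 2 * t powr Q x)) \<le> ennreal C"
    using pos g(2) by (subst ennreal_mult) auto
  hence "g y powr P y * (b / 2 * t powr Q x) \<le> C" using C(2) by (simp add: ennreal_le_iff)
  with y show ?thesis by (auto simp: good_def)
qed

text \<open>The defining inequality yields \<open>g(y) \<le> const t\<^sup>-\<^sup>Q\<^sup>(\<^sup>x\<^sup>)\<^sup>/\<^sup>P\<^sup>(\<^sup>y\<^sup>)\<close>; log-Hoelder continuity replaces
  \<open>P(y)\<close> by \<open>P(x)\<close> and \<open>S(y)\<close> by \<open>S(x)\<close> at the price of two exponential factors.\<close>

lemma good_bound:
  assumes x: "x \<notin> Z" and t: "0 < t" "t \<le> 1" and y: "good g C x t y" "0 \<le> g y" and C: "0 \<le> C"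
  shows "t powr S y * g y \<le> K_good C * t powr (- decay x)"
proof -
  have yZ: "y \<notin> Z" and d: "dist x y < t" and gy: "g y powr P y * (b / 2 * t powr Q x) \<le> C"
    using y by (auto simp: good_def)
  note Py = P_pos[OF yZ] and Px = P_pos[OF x]
  have "g y powr P y \<le> (2 * C / b) * t powr (- Q x)"
    using gy t pos by (simp add: powr_minus field_simps)
  hence "(g y powr P y) powr (1 / P y) \<le> ((2 * C / b) * t powr (- Q x)) powr (1 / P y)"
    using Py by (intro powr_mono2) auto
  also have "(g y powr P y) powr (1 / P y) = g y" using Py y(2) by (simp add: powr_powr)
  also have "((2 * C / b) * t powr (- Q x)) powr (1 / P y) = (2 * C / b) powr (1 / P y) * t powr (- (Q x / P y))"
    using C pos by (subst powr_mult) (auto simp: powr_powr)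
  finally have "g y \<le> (2 * C / b) powr (1 / P y) * t powr (- (Q x / P y))" .
  also have "(2 * C / b) powr (1 / P y) \<le> max 1 (2 * C / b) powr (1 / pm)"
  proof -
    have "(2 * C / b) powr (1 / P y) \<le> max 1 (2 * C / b) powr (1 / P y)"
      using C pos Py by (intro powr_mono2) auto
    also have "\<dots> \<le> max 1 (2 * C / b) powr (1 / pm)"
      using P_bounds[OF yZ] pos by (intro powr_mono) (auto intro: frac_le)
    finally show ?thesis .
  qed
  also have "t powr (- (Q x / P y)) \<le> exp (QM * L) * t powr (- (Q x / P x))"
  proof (rule powr_le_exp_mult_powr[OF t])
    have "\<bar>- (Q x / P x) - - (Q x / P y)\<bar> = Q x * \<bar>1 / P x - 1 / P y\<bar>"
    proof -
      have "- (Q x / P x) - - (Q x / P y) = - (Q x * (1 / P x - 1 / P y))" by (simp add: algebra_simps)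
      thus ?thesis using Q_pos[OF x] by (simp add: abs_mult)
    qed
    hence "\<bar>- (Q x / P x) - - (Q x / P y)\<bar> * ln (1 / t) = Q x * (\<bar>1 / P x - 1 / P y\<bar> * ln (1 / t))"
      by simp
    also have "\<dots> \<le> QM * L"
      using P_osc(1)[OF x yZ d t(2)] Q_bound[OF x] Q_pos[OF x] QM_pos t by (intro mult_mono) auto
    finally show "\<bar>- (Q x / P x) - - (Q x / P y)\<bar> * ln (1 / t) \<le> QM * L" .
  qed
  finally have *: "g y \<le> max 1 (2 * C / b) powr (1 / pm) * (exp (QM * L) * t powr (- (Q x / P x)))"
    by (simp add: mult_right_mono mult_left_mono)
  have "t powr S y \<le> exp (sM\<^sup>2 * L) * t powr S x"
    using S_osc[OF x yZ d t(2)] by (rule powr_le_exp_mult_powr[OF t])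
  hence "t powr S y * g y \<le> (exp (sM\<^sup>2 * L) * t powr S x) *
      (max 1 (2 * C / b) powr (1 / pm) * (exp (QM * L) * t powr (- (Q x / P x))))"
    using * y(2) by (intro mult_mono) auto
  also have "\<dots> = K_good C * (t powr S x * t powr (- (Q x / P x)))" by (simp add: K_good_def)
  also have "t powr S x * t powr (- (Q x / P x)) = t powr (- decay x)"
    by (simp add: decay_def flip: powr_add)
  finally show ?thesis .
qed

lemma K_good_nonneg: "0 \<le> K_good C" by (simp add: K_good_def)

lemma K_chain:
  "1 + 2 * 3 powr sM * K_good C \<le> K_chain C"
  "2 * 3 powr sM * K_good C + K_chain C * 2 powr (- (c / pM)) \<le> K_chain C"
proof -
  define \<kappa> where "\<kappa> = 2 * 3 powr sM * K_good C"
  define \<theta> :: real where "\<theta> = 2 powr (- (c / pM))"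
  have \<theta>: "0 < \<theta>" "\<theta> < 1" using pos pM_pos by (auto simp: \<theta>_def powr_less_one)
  have \<kappa>: "0 \<le> \<kappa>" using K_good_nonneg by (simp add: \<kappa>_def)
  have eq: "K_chain C * (1 - \<theta>) = \<kappa> + 1" using \<theta> by (simp only: K_chain_def flip: \<kappa>_def \<theta>_def) simp
  have "(\<kappa> + 1) * (1 - \<theta>) \<le> \<kappa> + 1" using \<kappa> \<theta> by (simp add: mult_left_le)
  hence "(\<kappa> + 1) * (1 - \<theta>) \<le> K_chain C * (1 - \<theta>)" using eq by simp
  hence "\<kappa> + 1 \<le> K_chain C" using \<theta> by (simp add: mult_le_cancel_right)
  thus "1 + 2 * 3 powr sM * K_good C \<le> K_chain C" by (simp add: \<kappa>_def)
  have "\<kappa> + K_chain C * \<theta> \<le> K_chain C" using eq by (simp add: algebra_simps)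
  thus "2 * 3 powr sM * K_good C + K_chain C * 2 powr (- (c / pM)) \<le> K_chain C"
    by (simp add: \<kappa>_def \<theta>_def)
qed

lemma K_chain_nonneg: "0 \<le> K_chain C"
  using mult_nonneg_nonneg[of "2 * 3 powr sM" "K_good C"] K_good_nonneg
  by (intro order.trans[OF _ K_chain(1)]) simp

lemma jump_between_good_points:
  assumes x: "x \<notin> Z" and t: "0 < t" "t \<le> t'" "t' \<le> 2 * t" "t' \<le> 1"
    and y: "good g C x t y" "y \<notin> N" and y': "good g C x t' y'" "y' \<notin> N" and C: "0 \<le> C"
    and w: "gradient_off S w g N"
  shows "\<bar>w y - w y'\<bar> \<le> 2 * 3 powr sM * K_good C * t powr (- decay x)"
proof -
  have g: "0 \<le> g z" for z using w by (simp add: gradient_off_def)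
  have term_bound: "dist y y' powr S z * g z \<le> 3 powr sM * (K_good C * \<tau> powr (- decay x))"
    if z: "good g C x \<tau> z" and \<tau>: "0 < \<tau>" "\<tau> \<le> 1" "dist y y' \<le> 3 * \<tau>" for z \<tau>
  proof -
    have zZ: "z \<notin> Z" using z by (simp add: good_def)
    have "dist y y' powr S z * g z \<le> (3 * \<tau>) powr S z * g z"
      using \<tau> S_pos[OF zZ] g by (intro mult_right_mono powr_mono2) auto
    also have "\<dots> = 3 powr S z * (\<tau> powr S z * g z)" using \<tau> by (simp add: powr_mult)
    also have "\<dots> \<le> 3 powr sM * (K_good C * \<tau> powr (- decay x))"
    proof (rule mult_mono)
      show "3 powr S z \<le> 3 powr sM" using S_bounds[OF zZ] by (intro powr_mono) auto
      show "\<tau> powr S z * g z \<le> K_good C * \<tau> powr (- decay x)" by (rule good_bound[OF x \<tau>(1,2) z g C])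
    qed (use g in auto)
    finally show ?thesis .
  qed
  have "dist y y' < t + t'" using y y' dist_triangle3[of y y' x] unfolding good_def by linarith
  hence d: "dist y y' \<le> 3 * t" "dist y y' \<le> 3 * t'" using t by auto
  have yN: "y \<in> - N" "y' \<in> - N" using y y' by auto
  have "\<bar>w y - w y'\<bar> \<le> dist y y' powr S y * g y + dist y y' powr S y' * g y'"
    using w yN unfolding gradient_off_def by blast
  also have "\<dots> \<le> 3 powr sM * (K_good C * t powr (- decay x)) + 3 powr sM * (K_good C * t' powr (- decay x))"
    using t d y y' by (intro add_mono term_bound) auto
  also have "\<dots> \<le> 3 powr sM * (K_good C * t powr (- decay x)) + 3 powr sM * (K_good C * t powr (- decay x))"
  proof -
    have "0 < c / pM" using pos pM_pos by simp
    hence "t' powr (- decay x) \<le> t powr (- decay x)"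
      using t decay_bounds[OF x] by (intro powr_mono2') auto
    thus ?thesis using K_good_nonneg by (intro add_left_mono mult_left_mono) auto
  qed
  finally show ?thesis by simp
qed

text \<open>Induction on the number of doublings between \<open>t\<close> and \<open>\<rho>\<close>: at the top scale the chain ends outside \<open>E\<close>, where
  \<open>\<bar>w\<bar> \<le> 1\<close>, and below it the two inequalities for \<open>K_chain\<close> absorb one more step.\<close>

lemma chain_bound:
  assumes x: "x \<notin> Z" and \<rho>: "0 < \<rho>" "\<rho> \<le> 1" and C: "0 \<le> C"
    and g: "g \<in> borel_measurable \<mu>" "(\<integral>\<^sup>+y. ennreal (\<bar>g y\<bar> powr P y) \<partial>\<mu>) \<le> ennreal C"
    and N: "N \<in> null_sets \<mu>" and w: "gradient_off S w g N"
    and E: "E \<in> sets \<mu>" "emeasure \<mu> (E \<inter> ball x \<rho>) \<le> ennreal (b / 2 * \<rho> powr Q x)"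
      "\<And>y. y \<notin> E \<Longrightarrow> \<bar>w y\<bar> \<le> 1"
    and y: "0 < t" "t \<le> \<rho>" "good g C x t y" "y \<notin> N"
  shows "\<bar>w y\<bar> \<le> K_chain C * t powr (- decay x)"
proof -
  have g0: "\<And>z. 0 \<le> g z" using w by (simp add: gradient_off_def)
  have dec: "0 < decay x" using decay_bounds[OF x] divide_pos_pos[OF pos(3) pM_pos] by linarith
  define \<kappa> where "\<kappa> = 2 * 3 powr sM * K_good C"
  have \<kappa>: "0 \<le> \<kappa>" using K_good_nonneg by (simp add: \<kappa>_def)
  note K = K_chain[of C, folded \<kappa>_def]
  have base: "\<bar>w y\<bar> \<le> K_chain C * t powr (- decay x)"
    if t: "0 < t" "t \<le> \<rho>" "\<rho> \<le> 2 * t" and y: "good g C x t y" "y \<notin> N" for t y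
  proof -
    obtain y' where y': "good g C x \<rho> y'" "y' \<notin> E" "y' \<notin> N"
      using exists_good[OF x \<rho> E(1) N g(1) g0 E(2) g(2) C] by blast
    have "\<bar>w y - w y'\<bar> \<le> \<kappa> * t powr (- decay x)"
      unfolding \<kappa>_def using y t \<rho> y' by (intro jump_between_good_points[OF x _ _ _ _ _ _ _ _ C w]) auto
    moreover have "\<bar>w y'\<bar> \<le> 1" using E(3) y' by blast
    moreover have "1 \<le> t powr (- decay x)"
      using t \<rho> dec by (simp add: powr_minus one_le_inverse_iff powr_le1)
    ultimately have "\<bar>w y\<bar> \<le> (1 + \<kappa>) * t powr (- decay x)" by (simp add: distrib_right)
    also have "\<dots> \<le> K_chain C * t powr (- decay x)" using K by (intro mult_right_mono) auto
    finally show ?thesis .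
  qed
  have main: "\<bar>w y\<bar> \<le> K_chain C * t powr (- decay x)"
    if "0 < t" "t \<le> \<rho>" "\<rho> \<le> 2 ^ Suc n * t" "good g C x t y" "y \<notin> N" for n t y
    using that
  proof (induction n arbitrary: t y)
    case 0 thus ?case using base by simp
  next
    case (Suc n t y)
    show ?case
    proof (cases "2 * t \<le> \<rho>")
      case False
      thus ?thesis using Suc.prems by (intro base) auto
    next
      case True
      obtain y' where y': "good g C x (2 * t) y'" "y' \<notin> N"
        using exists_good[OF x, of "2 * t" "{}" N g C] N g C True Suc.prems \<rho> g0 by auto
      have "\<bar>w y - w y'\<bar> \<le> \<kappa> * t powr (- decay x)"
        unfolding \<kappa>_def using Suc.prems \<rho> y' True by (intro jump_between_good_points[OF x _ _ _ _ _ _ _ _ C w]) auto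
      moreover have "\<bar>w y'\<bar> \<le> K_chain C * (2 * t) powr (- decay x)"
        using Suc.prems True y' by (intro Suc.IH) (auto simp: field_simps)
      ultimately have "\<bar>w y\<bar> \<le> (\<kappa> + K_chain C * 2 powr (- decay x)) * t powr (- decay x)"
        using Suc.prems by (simp add: powr_mult algebra_simps)
      also have "\<dots> \<le> (\<kappa> + K_chain C * 2 powr (- (c / pM))) * t powr (- decay x)"
        using decay_bounds[OF x] K \<kappa>
        by (intro mult_right_mono add_left_mono mult_left_mono powr_mono) auto
      also have "\<dots> \<le> K_chain C * t powr (- decay x)" using K by (intro mult_right_mono) auto
      finally show ?thesis .
    qed
  qed
  obtain n where "\<rho> / t < 2 ^ n" using real_arch_pow[of 2 "\<rho> / t"] by auto
  hence "\<rho> < 2 ^ n * t" using y(1) by (simp add: field_simps)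
  moreover have "0 < 2 ^ n * t" using y(1) by simp
  ultimately have "\<rho> \<le> 2 ^ n * t + 2 ^ n * t" by linarith
  hence "\<rho> \<le> 2 ^ Suc n * t" by (simp add: algebra_simps)
  thus ?thesis by (rule main[OF y(1,2) _ y(3,4)])
qed

definition K_sup :: "real \<Rightarrow> real \<Rightarrow> real" where
  "K_sup C \<rho> = 1 + (K_chain C + K_good C) * \<rho> powr (- (QM / pm))"

text \<open>With \<open>G = max 1 g(x)\<close>, the radius \<open>t = \<rho> G\<^sup>-\<^sup>P\<^sup>/\<^sup>Q\<close> balances the two terms \<open>t\<^sup>S G\<close> and \<open>t\<^sup>S\<^sup>-\<^sup>Q\<^sup>/\<^sup>P\<close>,
  a pointwise replacement for the maximal-function argument in the proof of the Sobolev inequality.\<close>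

lemma pointwise_bound:
  assumes x: "x \<notin> Z" "x \<notin> N" and \<rho>: "0 < \<rho>" "\<rho> \<le> 1" and C: "0 \<le> C"
    and g: "g \<in> borel_measurable \<mu>" "(\<integral>\<^sup>+y. ennreal (\<bar>g y\<bar> powr P y) \<partial>\<mu>) \<le> ennreal C"
    and N: "N \<in> null_sets \<mu>" and w: "gradient_off S w g N"
    and E: "E \<in> sets \<mu>" "emeasure \<mu> (E \<inter> ball x \<rho>) \<le> ennreal (b / 2 * \<rho> powr Q x)"
      "\<And>y. y \<notin> E \<Longrightarrow> \<bar>w y\<bar> \<le> 1"
  shows "\<bar>w x\<bar> \<le> K_sup C \<rho> * max 1 (g x) powr ((Q x - S x * P x) / Q x)"
proof -
  define G where "G = max 1 (g x)"
  define t where "t = \<rho> * G powr (- (P x / Q x))"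
  note Q = Q_pos[OF x(1)] and P = P_pos[OF x(1)] and S = S_pos[OF x(1)]
  have g0: "\<And>z. 0 \<le> g z" using w by (simp add: gradient_off_def)
  have G: "1 \<le> G" "g x \<le> G" by (auto simp: G_def)
  have "G powr (- (P x / Q x)) \<le> 1" using G Q P by (simp add: powr_minus inverse_le_1_iff ge_one_powr_ge_zero)
  hence t: "0 < t" "t \<le> \<rho>" "t \<le> 1" using G \<rho> by (auto simp: t_def mult_le_one mult_left_le)
  obtain y where y: "good g C x t y" "y \<notin> N"
    using exists_good[OF x(1) t(1,3), of "{}" N g C] N g C g0 by auto
  hence yZ: "y \<notin> Z" and d: "dist x y \<le> t" by (auto simp: good_def)
  have wy: "\<bar>w y\<bar> \<le> K_chain C * t powr (- decay x)"
    by (rule chain_bound[OF x(1) \<rho> C g N w E t(1,2) y])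
  have "\<bar>w x - w y\<bar> \<le> dist x y powr S x * g x + dist x y powr S y * g y"
    using w x y unfolding gradient_off_def by blast
  also have "\<dots> \<le> t powr S x * G + t powr S y * g y"
    using d g0 G S S_pos[OF yZ] by (intro add_mono mult_mono mult_right_mono powr_mono2) auto
  also have "t powr S y * g y \<le> K_good C * t powr (- decay x)"
    by (rule good_bound[OF x(1) t(1,3) y(1) g0 C])
  finally have *: "\<bar>w x\<bar> \<le> t powr S x * G + (K_chain C + K_good C) * t powr (- decay x)"
    using wy by (simp add: algebra_simps)
  let ?\<theta> = "(Q x - S x * P x) / Q x"
  have "t powr S x * G = \<rho> powr S x * (G powr (- (P x / Q x) * S x) * G powr 1)"
    using G \<rho> by (simp add: t_def powr_mult powr_powr)
  also have "\<dots> = \<rho> powr S x * G powr ?\<theta>"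
    using Q by (simp only: powr_add[symmetric]) (simp add: field_simps)
  also have "\<dots> \<le> 1 * G powr ?\<theta>" using \<rho> S by (intro mult_right_mono powr_le1) auto
  finally have 1: "t powr S x * G \<le> G powr ?\<theta>" by simp
  have "t powr (- decay x) = \<rho> powr (- decay x) * G powr (- (P x / Q x) * (- decay x))"
    using G \<rho> by (simp add: t_def powr_mult powr_powr)
  also have "- (P x / Q x) * (- decay x) = ?\<theta>" using P Q by (simp add: decay_def field_simps)
  also have "\<rho> powr (- decay x) \<le> \<rho> powr (- (QM / pm))"
    using decay_bounds[OF x(1)] \<rho> by (intro powr_mono') auto
  finally have 2: "t powr (- decay x) \<le> \<rho> powr (- (QM / pm)) * G powr ?\<theta>" by (simp add: mult_right_mono)
  have "\<bar>w x\<bar> \<le> G powr ?\<theta> + (K_chain C + K_good C) * (\<rho> powr (- (QM / pm)) * G powr ?\<theta>)"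
    using 1 2 K_good_nonneg K_chain_nonneg by (intro order.trans[OF *] add_mono mult_left_mono) auto
  thus ?thesis by (simp add: K_sup_def G_def algebra_simps)
qed

section \<open>Functions small in measure on balls have small modular\<close>

definition gamma_max :: real where "gamma_max = QM * pM / c"

lemma critical_le_gamma_max:
  assumes "x \<notin> Z" shows "Q x * P x / (Q x - S x * P x) \<le> gamma_max"
  unfolding gamma_max_def using Q_bound[OF assms] P_bounds[OF assms] Q_pos[OF assms] P_pos[OF assms] subcritical[OF assms] pos QM_pos
  by (intro frac_le mult_mono) auto

lemma q_le_gamma_max: "x \<notin> Z \<Longrightarrow> q x \<le> gamma_max" using critical_le_gamma_max[of x] q_below[of x] pos by linarith

lemma q_pos: "x \<notin> Z \<Longrightarrow> 0 < q x" using q_above[of x] P_pos[of x] pos by linarith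

lemma low_bound:
  assumes x: "x \<notin> Z" and w: "\<bar>w x\<bar> \<le> h" and h: "0 < h" "h \<le> 1"
  shows "\<bar>w x\<bar> powr q x \<le> h powr c * \<bar>w x\<bar> powr P x"
proof -
  have "\<bar>w x\<bar> powr q x = \<bar>w x\<bar> powr (q x - P x) * \<bar>w x\<bar> powr P x"
    by (simp flip: powr_add)
  also have "\<bar>w x\<bar> powr (q x - P x) \<le> h powr (q x - P x)"
    using w q_above[OF x] pos by (intro powr_mono2) auto
  also have "\<dots> \<le> h powr c" using h q_above[OF x] by (intro powr_mono') auto
  finally show ?thesis by (simp add: mult_right_mono)
qed

text \<open>Since \<open>\<bar>w(x)\<bar>\<close> exceeds \<open>K\<close>, \<open>g(x) > 1\<close> and the bound on \<open>w\<close> raised to the critical exponent \<open>\<gamma>\<close> is a multiple of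
  \<open>g\<^sup>P\<close>. The gap between \<open>q\<close> and \<open>\<gamma>\<close> contributes the factor \<open>\<bar>w(x)\<bar>\<^sup>-\<^sup>c \<le> A\<^sup>-\<^sup>c\<close>.\<close>

lemma high_bound:
  assumes x: "x \<notin> Z" and w: "\<bar>w x\<bar> \<le> K * max 1 (g x) powr ((Q x - S x * P x) / Q x)"
    and A: "1 \<le> K" "K \<le> A" "A < \<bar>w x\<bar>" and g: "0 \<le> g x"
  shows "\<bar>w x\<bar> powr q x \<le> (1 / A) powr c * K powr gamma_max * g x powr P x"
proof -
  define \<gamma> where "\<gamma> = Q x * P x / (Q x - S x * P x)"
  have gap: "0 < Q x - S x * P x" using subcritical[OF x] pos by linarith
  have \<gamma>: "0 < \<gamma>" using Q_pos[OF x] P_pos[OF x] gap by (simp add: \<gamma>_def)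
  have "1 < g x"
  proof (rule ccontr)
    assume "\<not> 1 < g x"
    hence "max 1 (g x) = 1" by simp
    hence "\<bar>w x\<bar> \<le> K" using w by simp
    thus False using A by simp
  qed
  hence m: "max 1 (g x) = g x" by simp
  have "\<bar>w x\<bar> powr q x \<le> \<bar>w x\<bar> powr (\<gamma> - c)"
    using A q_below[OF x] by (intro powr_mono) (auto simp: \<gamma>_def)
  also have "\<dots> = \<bar>w x\<bar> powr (- c) * \<bar>w x\<bar> powr \<gamma>" by (simp flip: powr_add)
  also have "\<dots> \<le> A powr (- c) * (K * g x powr ((Q x - S x * P x) / Q x)) powr \<gamma>"
    using A pos \<gamma> w m by (intro mult_mono powr_mono2 powr_mono2') auto
  also have "(K * g x powr ((Q x - S x * P x) / Q x)) powr \<gamma> = K powr \<gamma> * g x powr P x"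
    using A \<open>1 < g x\<close> gap Q_pos[OF x] P_pos[OF x] by (subst powr_mult) (auto simp: powr_powr \<gamma>_def)
  also have "A powr (- c) * (K powr \<gamma> * g x powr P x) \<le> A powr (- c) * (K powr gamma_max * g x powr P x)"
    using A critical_le_gamma_max[OF x] by (intro mult_left_mono mult_right_mono powr_mono) (auto simp: \<gamma>_def)
  finally show ?thesis using A by (simp add: powr_minus powr_divide inverse_eq_divide)
qed

definition K_mid :: "real \<Rightarrow> real \<Rightarrow> real" where
  "K_mid C t = 4 powr gamma_max * max 1 (2 / (b * t powr QM)) powr (gamma_max / pm) * C powr (gamma_max / pm)"

text \<open>Here \<open>\<bar>w(x)\<bar> \<le> 2 \<bar>w(x) - w(y)\<bar>\<close> for a point \<open>y\<close> with \<open>\<bar>w(y)\<bar> \<le> \<eta>\<close> from \<open>exists_good_point\<close>. If the term at \<open>x\<close> dominates, the power \<open>t\<^sup>S\<close>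
  supplies the small factor. If the term at \<open>y\<close> dominates, \<open>\<bar>w(x)\<bar>\<^sup>q\<close> is bounded by a multiple of \<open>I\<^sup>q\<^sup>(\<^sup>x\<^sup>)\<^sup>/\<^sup>P\<^sup>(\<^sup>y\<^sup>)\<close>, which
  is a multiple of \<open>I\<close> only because \<open>q(x) \<ge> P(y)\<close>: this is the purpose of the third bound on \<open>t\<close>.\<close>

lemma middle_bound:
  assumes x: "x \<notin> Z" "x \<notin> N" and t: "0 < t" "t \<le> 1" "t \<le> exp (- (pM\<^sup>2 * L / c))"
    and g: "g \<in> borel_measurable \<mu>" and N: "N \<in> null_sets \<mu>" and w: "gradient_off S w g N"
    and E: "{y. \<eta> < \<bar>w y\<bar>} \<in> sets \<mu>" "emeasure \<mu> ({y. \<eta> < \<bar>w y\<bar>} \<inter> ball x t) \<le> ennreal (b / 2 * t powr Q x)"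
    and A: "1 \<le> A" "2 * \<eta> < \<bar>w x\<bar>" "\<bar>w x\<bar> \<le> A"
    and I: "(\<integral>\<^sup>+y\<in>ball x t. ennreal (\<bar>g y\<bar> powr P y) \<partial>\<mu>) = ennreal I" "0 \<le> I" "I \<le> C" "1 \<le> C"
  shows "\<bar>w x\<bar> powr q x \<le> A powr gamma_max * 4 powr pM * t powr (sm * pm) * g x powr P x + K_mid C t * I"
proof -
  have g0: "\<And>z. 0 \<le> g z" using w by (simp add: gradient_off_def)
  obtain y where y: "y \<in> ball x t" "\<not> \<eta> < \<bar>w y\<bar>" "y \<notin> N" and yZ: "y \<notin> Z"
    and le: "ennreal (\<bar>g y\<bar> powr P y) * ennreal (b / 2 * t powr Q x) \<le> ennreal I"
    using exists_good_point[OF x(1) t(1,2) E(1) N g E(2), unfolded I(1)] by blast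
  have "ennreal (g y powr P y * (b / 2 * t powr Q x)) \<le> ennreal I"
    using le pos g0 by (subst ennreal_mult) auto
  hence gy: "g y powr P y * (b / 2 * t powr Q x) \<le> I" using I by (simp add: ennreal_le_iff)
  have d: "dist x y < t" using y by simp
  have "\<bar>w x\<bar> \<le> 2 * (\<bar>w x\<bar> - \<bar>w y\<bar>)"
  proof -
    have "2 * \<bar>w y\<bar> \<le> 2 * \<eta>" using y(2) by simp
    also have "\<dots> \<le> \<bar>w x\<bar>" using A(2) by simp
    finally show ?thesis by simp
  qed
  also have "\<dots> \<le> 2 * \<bar>w x - w y\<bar>" using abs_triangle_ineq2 by (intro mult_left_mono) auto
  finally have double: "\<bar>w x\<bar> \<le> 2 * \<bar>w x - w y\<bar>" .
  have "\<bar>w x - w y\<bar> \<le> dist x y powr S x * g x + dist x y powr S y * g y"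
    using w x y unfolding gradient_off_def by blast
  also have "\<dots> \<le> t powr S x * g x + 1 * g y"
    using d g0 t S_pos[OF x(1)] S_pos[OF yZ]
    by (intro add_mono mult_right_mono powr_mono2 powr_le1) auto
  finally have "\<bar>w x - w y\<bar> \<le> t powr S x * g x + 1 * g y" .
  hence sum: "\<bar>w x\<bar> \<le> 2 * (t powr S x * g x) + 2 * g y" by (intro order.trans[OF double]) simp
  have Px: "0 < P x" "pm \<le> P x" "P x \<le> pM" using P_pos P_bounds x by auto
  have Py: "0 < P y" "pm \<le> P y" using P_pos P_bounds yZ by auto
  have qx: "P x + c \<le> q x" "q x \<le> gamma_max" "0 < q x" using q_above q_le_gamma_max q_pos x by auto
  show ?thesis
  proof (cases "g y \<le> t powr S x * g x")
    case True
    hence *: "\<bar>w x\<bar> \<le> 4 * (t powr S x * g x)" using sum by simp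
    have "\<bar>w x\<bar> powr q x = \<bar>w x\<bar> powr (q x - P x) * \<bar>w x\<bar> powr P x" by (simp flip: powr_add)
    also have "\<dots> \<le> A powr gamma_max * (4 powr pM * (t powr (sm * pm) * g x powr P x))"
    proof (intro mult_mono)
      have "\<bar>w x\<bar> powr (q x - P x) \<le> A powr (q x - P x)" using A qx pos by (intro powr_mono2) auto
      also have "\<dots> \<le> A powr gamma_max" using A qx Px by (intro powr_mono) auto
      finally show "\<bar>w x\<bar> powr (q x - P x) \<le> A powr gamma_max" .
      have "\<bar>w x\<bar> powr P x \<le> (4 * (t powr S x * g x)) powr P x" using * Px by (intro powr_mono2) auto
      also have "\<dots> = 4 powr P x * (t powr (S x * P x) * g x powr P x)"
        using g0 by (simp add: powr_mult powr_powr)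
      also have "\<dots> \<le> 4 powr pM * (t powr (sm * pm) * g x powr P x)"
      proof (intro mult_mono)
        have "sm * pm \<le> S x * P x" using Px S_bounds[OF x(1)] pos by (intro mult_mono) auto
        thus "t powr (S x * P x) \<le> t powr (sm * pm)" using t by (intro powr_mono') auto
      qed (use Px in auto)
      finally show "\<bar>w x\<bar> powr P x \<le> 4 powr pM * (t powr (sm * pm) * g x powr P x)" .
    qed auto
    moreover have "0 \<le> K_mid C t * I" using I by (simp add: K_mid_def)
    ultimately show ?thesis by (simp add: mult.assoc)
  next
    case False
    hence *: "\<bar>w x\<bar> \<le> 4 * g y" using sum by simp
    define Y where "Y = max 1 (2 / (b * t powr QM))"
    have Y: "1 \<le> Y" by (simp add: Y_def)
    define e where "e = q x / P y"
    have "\<bar>P x - P y\<bar> * (pM\<^sup>2 * L / c) \<le> \<bar>P x - P y\<bar> * ln (1 / t)"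
    proof (intro mult_left_mono)
      have "ln t \<le> - (pM\<^sup>2 * L / c)" using t by (metis ln_le_cancel_iff exp_gt_zero ln_exp)
      thus "pM\<^sup>2 * L / c \<le> ln (1 / t)" using t by (simp add: ln_div)
    qed auto
    also have "\<dots> \<le> pM\<^sup>2 * L" using P_osc(2)[OF x(1) yZ d t(2)] .
    finally have osc: "\<bar>P x - P y\<bar> * (pM\<^sup>2 * L) \<le> c * (pM\<^sup>2 * L)" using pos by (simp add: field_simps)
    have "\<bar>P x - P y\<bar> \<le> c"
    \<comment> \<open>For \<open>L = 0\<close> the third bound on \<open>t\<close> carries no information, but \<open>P\<close> is constant off \<open>Z\<close>.\<close>
    proof (cases "L = 0")
      case True
      hence "1 / P x = 1 / P y" using P_log[OF x(1) yZ] by simp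
      hence "P x = P y" using Px Py by (simp add: field_simps)
      thus ?thesis using pos by simp
    next
      case False
      hence "0 < pM\<^sup>2 * L" using pos pM_pos by simp
      thus ?thesis using osc mult_le_cancel_right_pos by blast
    qed
    hence "P y \<le> q x" using qx by linarith
    hence e1: "1 \<le> e" using Py by (simp add: e_def)
    have e2: "e \<le> gamma_max / pm" unfolding e_def using qx Py pos by (intro frac_le) auto
    have "t powr QM \<le> t powr Q x" using Q_bound[OF x(1)] t by (intro powr_mono') auto
    hence "g y powr P y * (b / 2 * t powr QM) \<le> g y powr P y * (b / 2 * t powr Q x)"
      using pos by (intro mult_left_mono) auto
    also note gy
    finally have "g y powr P y \<le> 2 / (b * t powr QM) * I" using pos t by (simp add: field_simps)
    also have "\<dots> \<le> Y * I" using I by (intro mult_right_mono) (auto simp: Y_def)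
    finally have gP: "g y powr P y \<le> Y * I" .
    have "\<bar>w x\<bar> powr q x \<le> (4 * g y) powr q x" using * qx by (intro powr_mono2) auto
    also have "\<dots> = 4 powr q x * (g y powr P y) powr e" using g0 Py by (simp add: powr_mult powr_powr e_def)
    also have "\<dots> \<le> 4 powr gamma_max * (Y powr (gamma_max / pm) * (C powr (gamma_max / pm) * I))"
    proof (intro mult_mono)
      show "4 powr q x \<le> 4 powr gamma_max" using qx by (intro powr_mono) auto
      have "(g y powr P y) powr e \<le> (Y * I) powr e" using gP e1 by (intro powr_mono2) auto
      also have "\<dots> = Y powr e * I powr e" using Y I by (simp add: powr_mult)
      also have "\<dots> \<le> Y powr (gamma_max / pm) * (C powr (gamma_max / pm) * I)"
      proof (intro mult_mono)
        show "Y powr e \<le> Y powr (gamma_max / pm)" using Y e2 by (intro powr_mono) auto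
        have "I powr e = C powr e * (I / C) powr e" using I by (simp flip: powr_mult)
        also have "\<dots> \<le> C powr (gamma_max / pm) * (I / C) powr 1"
          using I e1 e2 by (intro mult_mono powr_mono powr_mono') auto
        also have "\<dots> \<le> C powr (gamma_max / pm) * I" using I by (intro mult_left_mono) (use I mult_right_mono[of 1 C I] in \<open>auto simp: field_simps\<close>)
        finally show "I powr e \<le> C powr (gamma_max / pm) * I" .
      qed (use I in auto)
      finally show "(g y powr P y) powr e \<le> Y powr (gamma_max / pm) * (C powr (gamma_max / pm) * I)" .
    qed (use I in auto)
    also have "\<dots> = K_mid C t * I" by (simp add: K_mid_def Y_def)
    finally show ?thesis using A by (simp add: add_increasing)
  qed
qed

text \<open>Exchanging the integrals turns the left-hand side into the integral of \<open>f(y) \<mu>(E \<inter> B(y,t))\<close>.\<close>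

lemma integral_over_small_set:
  assumes f [measurable]: "f \<in> borel_measurable \<mu>" and E [measurable]: "E \<in> sets \<mu>"
    and small: "\<And>y. emeasure \<mu> (E \<inter> ball y t) \<le> \<sigma>"
  shows "(\<lambda>x. \<integral>\<^sup>+y\<in>ball x t. f y \<partial>\<mu>) \<in> borel_measurable \<mu>"
    "(\<integral>\<^sup>+x\<in>E. (\<integral>\<^sup>+y\<in>ball x t. f y \<partial>\<mu>) \<partial>\<mu>) \<le> \<sigma> * (\<integral>\<^sup>+y. f y \<partial>\<mu>)"
proof -
  interpret sigma_finite_measure \<mu> by (rule sigma_finite)
  interpret pair_sigma_finite \<mu> \<mu> ..
  obtain \<Delta> :: "'a set" where "countable \<Delta>" "\<And>x e. e > 0 \<Longrightarrow> \<exists>z\<in>\<Delta>. dist x z < e"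
    using doubling_countable_dense[OF doubling] by blast
  hence W [measurable]: "{(x, y). dist x y < t} \<in> sets (\<mu> \<Otimes>\<^sub>M \<mu>)"
    by (rule sets_pair_dist_less) auto
  define W where "W = {(x::'a, y). dist x y < t}"
  have [measurable]: "W \<in> sets (\<mu> \<Otimes>\<^sub>M \<mu>)" using W by (simp add: W_def)
  have *: "(\<integral>\<^sup>+y\<in>ball x t. f y \<partial>\<mu>) = (\<integral>\<^sup>+y. f y * indicator W (x, y) \<partial>\<mu>)" for x
    by (intro nn_integral_cong) (auto simp: indicator_def W_def)
  show "(\<lambda>x. \<integral>\<^sup>+y\<in>ball x t. f y \<partial>\<mu>) \<in> borel_measurable \<mu>"
    unfolding * by measurable
  have "(\<integral>\<^sup>+x\<in>E. (\<integral>\<^sup>+y\<in>ball x t. f y \<partial>\<mu>) \<partial>\<mu>)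
      = (\<integral>\<^sup>+x. (\<integral>\<^sup>+y. f y * indicator W (x, y) * indicator E x \<partial>\<mu>) \<partial>\<mu>)"
    unfolding * by (intro nn_integral_cong nn_integral_multc[symmetric]) measurable
  also have "\<dots> = (\<integral>\<^sup>+y. (\<integral>\<^sup>+x. f y * indicator W (x, y) * indicator E x \<partial>\<mu>) \<partial>\<mu>)"
    by (intro Fubini'[symmetric]) measurable
  also have "\<dots> = (\<integral>\<^sup>+y. f y * emeasure \<mu> (E \<inter> ball y t) \<partial>\<mu>)"
  proof (intro nn_integral_cong)
    fix y
    have "(\<integral>\<^sup>+x. f y * indicator W (x, y) * indicator E x \<partial>\<mu>) = (\<integral>\<^sup>+x. f y * indicator (E \<inter> ball y t) x \<partial>\<mu>)"
      by (intro nn_integral_cong) (auto simp: indicator_def W_def dist_commute)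
    also have "\<dots> = f y * emeasure \<mu> (E \<inter> ball y t)"
      using E by (intro nn_integral_cmult_indicator) auto
    finally show "(\<integral>\<^sup>+x. f y * indicator W (x, y) * indicator E x \<partial>\<mu>) = f y * emeasure \<mu> (E \<inter> ball y t)" .
  qed
  also have "\<dots> \<le> (\<integral>\<^sup>+y. f y * \<sigma> \<partial>\<mu>)" using small by (intro nn_integral_mono mult_left_mono) auto
  also have "\<dots> = \<sigma> * (\<integral>\<^sup>+y. f y \<partial>\<mu>)" by (simp add: nn_integral_cmult mult.commute)
  finally show "(\<integral>\<^sup>+x\<in>E. (\<integral>\<^sup>+y\<in>ball x t. f y \<partial>\<mu>) \<partial>\<mu>) \<le> \<sigma> * (\<integral>\<^sup>+y. f y \<partial>\<mu>)" .
qed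

lemma K_sup_ge_1: "1 \<le> K_sup C \<rho>"
  using K_chain_nonneg K_good_nonneg by (simp add: K_sup_def)

lemma modular_q_bound:
  assumes C: "1 \<le> C" and \<rho>: "0 < \<rho>" "\<rho> \<le> 1" and h: "0 < \<eta>" "2 * \<eta> \<le> 1" and A: "K_sup C \<rho> \<le> A"
    and t: "0 < t" "t \<le> \<rho>" "t \<le> exp (- (pM\<^sup>2 * L / c))"
    and \<sigma>: "0 < \<sigma>" "\<sigma> \<le> b / 2 * t powr QM"
    and w: "w \<in> borel_measurable \<mu>" "(\<integral>\<^sup>+x. ennreal (\<bar>w x\<bar> powr P x) \<partial>\<mu>) \<le> ennreal C"
    and g: "g \<in> borel_measurable \<mu>" "(\<integral>\<^sup>+x. ennreal (\<bar>g x\<bar> powr P x) \<partial>\<mu>) \<le> ennreal C"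
    and N: "N \<in> null_sets \<mu>" and grad: "gradient_off S w g N"
    and small: "\<And>x. emeasure \<mu> ({y. \<eta> < \<bar>w y\<bar>} \<inter> ball x \<rho>) \<le> ennreal \<sigma>"
  shows "(\<integral>\<^sup>+x. ennreal (\<bar>w x\<bar> powr q x) \<partial>\<mu>)
    \<le> ennreal ((2 * \<eta>) powr c * C + (1 / A) powr c * K_sup C \<rho> powr gamma_max * C
        + A powr gamma_max * 4 powr pM * t powr (sm * pm) * C + K_mid C t * (\<sigma> * C))"
proof -
  define E where "E = {y. \<eta> < \<bar>w y\<bar>}"
  have E [measurable]: "E \<in> sets \<mu>"
    using borel_measurable_less[OF borel_measurable_const[of \<eta>] borel_measurable_abs[OF w(1)]]
    by (simp add: E_def)
  have [measurable]: "w \<in> borel_measurable \<mu>" "g \<in> borel_measurable \<mu>" using w g by auto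
  have g0: "\<And>z. 0 \<le> g z" using grad by (simp add: gradient_off_def)
  define fw where "fw = (\<lambda>x. ennreal (\<bar>w x\<bar> powr P x))"
  define fg where "fg = (\<lambda>x. ennreal (\<bar>g x\<bar> powr P x))"
  have [measurable]: "fw \<in> borel_measurable \<mu>" "fg \<in> borel_measurable \<mu>" unfolding fw_def fg_def by measurable
  define I where "I = (\<lambda>x. \<integral>\<^sup>+y\<in>ball x t. fg y \<partial>\<mu>)"
  have small_t: "emeasure \<mu> (E \<inter> ball x t) \<le> ennreal \<sigma>" for x
  proof -
    have "emeasure \<mu> (E \<inter> ball x t) \<le> emeasure \<mu> (E \<inter> ball x \<rho>)"
      using t E by (intro emeasure_mono) auto
    thus ?thesis using small[of x] by (simp add: E_def)
  qed
  have I_meas [measurable]: "I \<in> borel_measurable \<mu>" 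
    and I_int: "(\<integral>\<^sup>+x\<in>E. I x \<partial>\<mu>) \<le> ennreal \<sigma> * (\<integral>\<^sup>+y. fg y \<partial>\<mu>)"
    unfolding I_def by (intro integral_over_small_set[OF _ E small_t]; measurable)+
  define a1 where "a1 = (2 * \<eta>) powr c"
  define a2 where "a2 = (1 / A) powr c * K_sup C \<rho> powr gamma_max"
  define a3 where "a3 = A powr gamma_max * 4 powr pM * t powr (sm * pm)"
  have a: "0 \<le> a1" "0 \<le> a2" "0 \<le> a3" by (auto simp: a1_def a2_def a3_def)
  have K_mid: "0 \<le> K_mid C t" by (simp add: K_mid_def)
  have A1: "1 \<le> A" using K_sup_ge_1[of C \<rho>] A by linarith
  have scale: "ennreal \<sigma> \<le> ennreal (b / 2 * t' powr Q x)" if x: "x \<notin> Z" and t': "t \<le> t'" "t' \<le> \<rho>" for x t'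
  proof (intro ennreal_leI)
    have "t powr QM \<le> t powr Q x" using Q_bound[OF x] t \<rho> by (intro powr_mono') auto
    also have "\<dots> \<le> t' powr Q x" using t t' Q_pos[OF x] by (intro powr_mono2) auto
    finally have "b / 2 * t powr QM \<le> b / 2 * t' powr Q x" using pos by (intro mult_left_mono) auto
    thus "\<sigma> \<le> b / 2 * t' powr Q x" using \<sigma> by linarith
  qed
  have "ennreal (\<bar>w x\<bar> powr q x)
      \<le> ennreal a1 * fw x + ennreal a2 * fg x + ennreal a3 * fg x + ennreal (K_mid C t) * (I x * indicator E x)"
    if x: "x \<notin> N \<union> Z" for x
  proof -
    have xZ: "x \<notin> Z" "x \<notin> N" using x by auto
    consider "\<bar>w x\<bar> \<le> 2 * \<eta>" | "2 * \<eta> < \<bar>w x\<bar>" "\<bar>w x\<bar> \<le> A" | "A < \<bar>w x\<bar>" by linarith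
    thus ?thesis
    proof cases
      case 1
      have "\<bar>w x\<bar> powr q x \<le> a1 * \<bar>w x\<bar> powr P x"
        unfolding a1_def using 1 h by (intro low_bound[OF xZ(1)]) auto
      hence "ennreal (\<bar>w x\<bar> powr q x) \<le> ennreal a1 * fw x"
        using a by (simp add: fw_def ennreal_leI flip: ennreal_mult)
      thus ?thesis by (simp add: add_increasing2 add.assoc)
    next
      case 2
      have "I x \<le> (\<integral>\<^sup>+y. fg y \<partial>\<mu>)" unfolding I_def by (intro nn_integral_mono) (auto simp: indicator_def)
      hence "I x \<le> ennreal C" using g(2) by (auto simp: fg_def)
      then obtain i where i: "I x = ennreal i" "0 \<le> i" "i \<le> C"
        using C by (cases "I x") (auto simp: ennreal_le_iff top_unique)
      have xE: "x \<in> E" using 2 h by (simp add: E_def)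
      have "\<bar>w x\<bar> powr q x \<le> a3 * g x powr P x + K_mid C t * i"
        unfolding a3_def
      proof (rule middle_bound[OF xZ t(1) _ t(3) g(1) N grad _ _ A1 2 _ i(2,3) C])
        show "t \<le> 1" using t \<rho> by simp
        show "{y. \<eta> < \<bar>w y\<bar>} \<in> sets \<mu>" using E by (simp add: E_def)
        show "emeasure \<mu> ({y. \<eta> < \<bar>w y\<bar>} \<inter> ball x t) \<le> ennreal (b / 2 * t powr Q x)"
          using small_t[of x] scale[OF xZ(1) _ t(2)] by (auto simp: E_def intro: order.trans)
        show "(\<integral>\<^sup>+y\<in>ball x t. ennreal (\<bar>g y\<bar> powr P y) \<partial>\<mu>) = ennreal i" using i(1) by (simp add: I_def fg_def)
      qed
      hence "ennreal (\<bar>w x\<bar> powr q x) \<le> ennreal (a3 * g x powr P x + K_mid C t * i)" by (rule ennreal_leI)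
      also have "\<dots> = ennreal a3 * fg x + ennreal (K_mid C t) * (I x * indicator E x)"
        using a K_mid i xE g0 by (simp add: fg_def ennreal_mult)
      finally show ?thesis by (simp add: add_increasing add.assoc)
    next
      case 3
      have "\<bar>w x\<bar> \<le> K_sup C \<rho> * max 1 (g x) powr ((Q x - S x * P x) / Q x)"
      proof (rule pointwise_bound[OF xZ \<rho> _ g N grad E])
        show "emeasure \<mu> (E \<inter> ball x \<rho>) \<le> ennreal (b / 2 * \<rho> powr Q x)"
          using small[of x] scale[OF xZ(1) t(2)] by (auto simp: E_def intro: order.trans)
        show "\<bar>w y\<bar> \<le> 1" if "y \<notin> E" for y using that h by (simp add: E_def)
      qed (use C in auto)
      hence "\<bar>w x\<bar> powr q x \<le> a2 * g x powr P x"
        unfolding a2_def using A 3 g0 by (intro high_bound[OF xZ(1) _ K_sup_ge_1]) auto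
      hence "ennreal (\<bar>w x\<bar> powr q x) \<le> ennreal a2 * fg x"
        using a g0 by (simp add: fg_def ennreal_leI flip: ennreal_mult)
      thus ?thesis by (simp add: add_increasing2 add_increasing)
    qed
  qed
  note pointwise = this
  have "N \<union> Z \<in> null_sets \<mu>" using N Z by auto
  hence "AE x in \<mu>. ennreal (\<bar>w x\<bar> powr q x)
      \<le> ennreal a1 * fw x + ennreal a2 * fg x + ennreal a3 * fg x + ennreal (K_mid C t) * (I x * indicator E x)"
    by (rule AE_mp[OF AE_not_in]) (intro AE_I2 impI pointwise)
  hence "(\<integral>\<^sup>+x. ennreal (\<bar>w x\<bar> powr q x) \<partial>\<mu>) \<le> (\<integral>\<^sup>+x. ennreal a1 * fw x + ennreal a2 * fg x + ennreal a3 * fg x + ennreal (K_mid C t) * (I x * indicator E x) \<partial>\<mu>)"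
    by (rule nn_integral_mono_AE)
  also have "\<dots> = ennreal a1 * (\<integral>\<^sup>+x. fw x \<partial>\<mu>) + ennreal a2 * (\<integral>\<^sup>+x. fg x \<partial>\<mu>) + ennreal a3 * (\<integral>\<^sup>+x. fg x \<partial>\<mu>)
      + ennreal (K_mid C t) * (\<integral>\<^sup>+x\<in>E. I x \<partial>\<mu>)"
    by (simp add: nn_integral_add nn_integral_cmult)
  also have "\<dots> \<le> ennreal a1 * ennreal C + ennreal a2 * ennreal C + ennreal a3 * ennreal C
      + ennreal (K_mid C t) * (ennreal \<sigma> * ennreal C)"
    using w(2) g(2) unfolding fw_def[symmetric] fg_def[symmetric]
    by (intro add_mono mult_left_mono order.trans[OF I_int]) auto
  also have "\<dots> = ennreal (a1 * C + a2 * C + a3 * C + K_mid C t * (\<sigma> * C))"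
    using a K_mid \<sigma> C by (simp add: ennreal_mult)
  finally show ?thesis by (simp add: a1_def a2_def a3_def)
qed

text \<open>The constants are chosen in the order \<open>\<eta>\<close>, \<open>A\<close>, \<open>t\<close>, \<open>\<sigma>\<close>, each making one of the four terms of \<open>modular_q_bound\<close> at most
  \<open>\<epsilon>/4\<close>. The cut-off \<open>A\<close> must not depend on \<open>t\<close>; this is why the chain runs up to the separate radius \<open>\<rho>\<close>.\<close>

theorem small_modular_of_small_in_measure:
  assumes C: "1 \<le> C" and \<rho>: "0 < \<rho>" "\<rho> \<le> 1" and \<epsilon>: "0 < \<epsilon>"
  obtains \<eta> \<sigma> where "0 < \<eta>" "\<eta> \<le> 1" "0 < \<sigma>"
    "\<And>w g N. \<lbrakk>w \<in> borel_measurable \<mu>; (\<integral>\<^sup>+x. ennreal (\<bar>w x\<bar> powr P x) \<partial>\<mu>) \<le> ennreal C;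
      g \<in> borel_measurable \<mu>; (\<integral>\<^sup>+x. ennreal (\<bar>g x\<bar> powr P x) \<partial>\<mu>) \<le> ennreal C;
      N \<in> null_sets \<mu>; gradient_off S w g N;
      \<And>x. emeasure \<mu> ({y. \<eta> < \<bar>w y\<bar>} \<inter> ball x \<rho>) \<le> ennreal \<sigma>\<rbrakk>
      \<Longrightarrow> (\<integral>\<^sup>+x. ennreal (\<bar>w x\<bar> powr q x) \<partial>\<mu>) \<le> ennreal \<epsilon>"
proof -
  have \<epsilon>4: "0 < \<epsilon> / 4" using \<epsilon> by simp
  obtain h where h: "0 < h" "h \<le> 1" "\<And>h'. 0 \<le> h' \<Longrightarrow> h' \<le> h \<Longrightarrow> h' powr c * C \<le> \<epsilon> / 4"
    using small_powr[OF pos(3) \<epsilon>4, of C] C by auto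
  obtain k where k: "0 < k" "k \<le> 1"
      "\<And>h'. 0 \<le> h' \<Longrightarrow> h' \<le> k \<Longrightarrow> h' powr c * (K_sup C \<rho> powr gamma_max * C) \<le> \<epsilon> / 4"
    using small_powr[OF pos(3) \<epsilon>4, of "K_sup C \<rho> powr gamma_max * C"] C by auto
  define A where "A = max (K_sup C \<rho>) (1 / k)"
  have A: "K_sup C \<rho> \<le> A" "0 < A" "1 / A \<le> k"
  proof -
    show "K_sup C \<rho> \<le> A" by (simp add: A_def)
    show "0 < A" using k by (simp add: A_def less_max_iff_disj)
    have "1 / k \<le> A" by (simp add: A_def)
    thus "1 / A \<le> k" using k \<open>0 < A\<close> by (simp add: field_simps)
  qed
  obtain t0 where t0: "0 < t0" "t0 \<le> 1"
      "\<And>h'. 0 \<le> h' \<Longrightarrow> h' \<le> t0 \<Longrightarrow> h' powr (sm * pm) * (A powr gamma_max * 4 powr pM * C) \<le> \<epsilon> / 4"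
    using small_powr[OF _ \<epsilon>4, of "sm * pm" "A powr gamma_max * 4 powr pM * C"] C pos by auto
  \<comment> \<open>The last bound makes \<open>P\<close> oscillate by at most \<open>c\<close> on balls of radius \<open>t\<close>.\<close>
  define t where "t = min (min \<rho> t0) (exp (- (pM\<^sup>2 * L / c)))"
  have t: "0 < t" "t \<le> \<rho>" "t \<le> exp (- (pM\<^sup>2 * L / c))" "t \<le> t0" using \<rho> t0 by (auto simp: t_def)
  have K_mid: "0 < K_mid C t" using C pos t by (simp add: K_mid_def)
  define \<sigma> where "\<sigma> = min (b / 2 * t powr QM) (\<epsilon> / 4 / (K_mid C t * C))"
  have \<sigma>: "0 < \<sigma>" "\<sigma> \<le> b / 2 * t powr QM" using pos t \<epsilon> K_mid C by (auto simp: \<sigma>_def)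
  have "\<sigma> * (K_mid C t * C) \<le> \<epsilon> / 4 / (K_mid C t * C) * (K_mid C t * C)"
    using K_mid C by (intro mult_right_mono) (auto simp: \<sigma>_def)
  hence \<sigma>3: "K_mid C t * (\<sigma> * C) \<le> \<epsilon> / 4" using K_mid C by (simp add: mult_ac)
  show thesis
  proof (rule that[of "h / 2" \<sigma>])
    show "0 < h / 2" "h / 2 \<le> 1" "0 < \<sigma>" using h \<sigma> by auto
  next
    fix w g N
    assume *: "w \<in> borel_measurable \<mu>" "(\<integral>\<^sup>+x. ennreal (\<bar>w x\<bar> powr P x) \<partial>\<mu>) \<le> ennreal C"
      "g \<in> borel_measurable \<mu>" "(\<integral>\<^sup>+x. ennreal (\<bar>g x\<bar> powr P x) \<partial>\<mu>) \<le> ennreal C"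
      "N \<in> null_sets \<mu>" "gradient_off S w g N"
      "\<And>x. emeasure \<mu> ({y. h / 2 < \<bar>w y\<bar>} \<inter> ball x \<rho>) \<le> ennreal \<sigma>"
    have "(\<integral>\<^sup>+x. ennreal (\<bar>w x\<bar> powr q x) \<partial>\<mu>) \<le> ennreal ((2 * (h / 2)) powr c * C + (1 / A) powr c * K_sup C \<rho> powr gamma_max * C
        + A powr gamma_max * 4 powr pM * t powr (sm * pm) * C + K_mid C t * (\<sigma> * C))"
      using h by (intro modular_q_bound[OF C \<rho> _ _ A(1) t(1-3) \<sigma> *]) auto
    also have "\<dots> \<le> ennreal \<epsilon>"
      using h(3)[of h] k(3)[of "1 / A"] t0(3)[of t] \<sigma>3 h(1) A t
      by (intro ennreal_leI) (simp add: mult_ac)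
    finally show "(\<integral>\<^sup>+x. ennreal (\<bar>w x\<bar> powr q x) \<partial>\<mu>) \<le> ennreal \<epsilon>" .
  qed
qed

section \<open>Modulars, symmetry and finite partitions\<close>

abbreviation modP :: "('a \<Rightarrow> real) \<Rightarrow> ennreal" where
  "modP u \<equiv> (\<integral>\<^sup>+x. ennreal (\<bar>u x\<bar> powr P x) \<partial>\<mu>)"

lemma AE_not_Z: "AE x in \<mu>. x \<notin> Z" using Z by (rule AE_not_in)

lemma measurable_modular_integrand:
  assumes [measurable]: "w \<in> borel_measurable \<mu>" "A \<in> sets \<mu>"
  shows "(\<lambda>x. ennreal (\<bar>w x\<bar> powr P x) * indicator A x) \<in> borel_measurable \<mu>"
  by measurable

lemma modP_scale_le:
  assumes u [measurable]: "u \<in> borel_measurable \<mu>" and \<theta>: "0 \<le> \<theta>" and K: "0 \<le> K" "\<And>x. x \<notin> Z \<Longrightarrow> \<theta> powr P x \<le> K"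
  shows "modP (\<lambda>x. \<theta> * u x) \<le> ennreal K * modP u"
proof -
  have "modP (\<lambda>x. \<theta> * u x) \<le> (\<integral>\<^sup>+x. ennreal K * ennreal (\<bar>u x\<bar> powr P x) \<partial>\<mu>)"
  proof (rule nn_integral_mono_AE, use AE_not_Z in eventually_elim)
    fix x assume x: "x \<notin> Z"
    have "\<bar>\<theta> * u x\<bar> powr P x = \<theta> powr P x * \<bar>u x\<bar> powr P x"
      using \<theta> by (simp add: abs_mult powr_mult)
    also have "\<dots> \<le> K * \<bar>u x\<bar> powr P x" using K(2)[OF x] by (intro mult_right_mono) auto
    finally show "ennreal (\<bar>\<theta> * u x\<bar> powr P x) \<le> ennreal K * ennreal (\<bar>u x\<bar> powr P x)"
      using K(1) by (simp add: ennreal_leI flip: ennreal_mult)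
  qed
  also have "\<dots> = ennreal K * modP u" by (intro nn_integral_cmult) measurable
  finally show ?thesis .
qed

lemma modP_shrink:
  assumes "u \<in> borel_measurable \<mu>" "0 \<le> \<theta>" "\<theta> \<le> 1"
  shows "modP (\<lambda>x. \<theta> * u x) \<le> ennreal (\<theta> powr pm) * modP u"
  using assms P_bounds by (intro modP_scale_le powr_mono') auto

lemma modP_stretch:
  assumes "u \<in> borel_measurable \<mu>" "0 \<le> \<theta>"
  shows "modP (\<lambda>x. \<theta> * u x) \<le> ennreal (max 1 \<theta> powr pM) * modP u"
proof (intro modP_scale_le assms)
  fix x assume x: "x \<notin> Z"
  have "\<theta> powr P x \<le> max 1 \<theta> powr P x" using assms P_pos[OF x] by (intro powr_mono2) auto
  also have "\<dots> \<le> max 1 \<theta> powr pM" using P_bounds[OF x] by (intro powr_mono) auto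
  finally show "\<theta> powr P x \<le> max 1 \<theta> powr pM" .
qed auto

lemma modP_add:
  assumes "u \<in> borel_measurable \<mu>" "v \<in> borel_measurable \<mu>" and f: "\<And>x. \<bar>f x\<bar> \<le> \<bar>u x\<bar> + \<bar>v x\<bar>"
  shows "modP f \<le> ennreal (2 powr pM) * (modP u + modP v)"
proof -
  have "modP f \<le> (\<integral>\<^sup>+x. ennreal (2 powr pM) * (ennreal (\<bar>u x\<bar> powr P x) + ennreal (\<bar>v x\<bar> powr P x)) \<partial>\<mu>)"
  proof (rule nn_integral_mono_AE, use AE_not_Z in eventually_elim)
    fix x assume x: "x \<notin> Z"
    have "\<bar>f x\<bar> powr P x \<le> (2 * max \<bar>u x\<bar> \<bar>v x\<bar>) powr P x"
      using f[of x] P_pos[OF x] by (intro powr_mono2) auto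
    also have "\<dots> = 2 powr P x * max \<bar>u x\<bar> \<bar>v x\<bar> powr P x" by (simp add: powr_mult)
    also have "\<dots> \<le> 2 powr pM * (\<bar>u x\<bar> powr P x + \<bar>v x\<bar> powr P x)"
      using P_bounds[OF x] by (intro mult_mono powr_mono) (auto simp: max_def)
    finally show "ennreal (\<bar>f x\<bar> powr P x)
        \<le> ennreal (2 powr pM) * (ennreal (\<bar>u x\<bar> powr P x) + ennreal (\<bar>v x\<bar> powr P x))"
      by (simp add: ennreal_leI flip: ennreal_mult ennreal_plus)
  qed
  also have "\<dots> = ennreal (2 powr pM) * (modP u + modP v)"
    using assms(1,2) by (simp add: nn_integral_cmult nn_integral_add)
  finally show ?thesis .
qed

lemma superlevel_sets [measurable]:
  fixes u :: "'a \<Rightarrow> real"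
  shows "u \<in> borel_measurable \<mu> \<Longrightarrow> {y. \<eta> < \<bar>u y\<bar>} \<in> sets \<mu>"
  using borel_measurable_less[OF borel_measurable_const[of \<eta>] borel_measurable_abs[of u \<mu>]] by simp

lemma Chebyshev:
  assumes u: "u \<in> borel_measurable \<mu>" and A: "A \<in> sets \<mu>" and \<eta>: "0 < \<eta>"
    and \<delta>: "\<And>x. x \<notin> Z \<Longrightarrow> \<delta> \<le> \<eta> powr P x"
  shows "ennreal \<delta> * emeasure \<mu> ({y. \<eta> < \<bar>u y\<bar>} \<inter> A) \<le> (\<integral>\<^sup>+x\<in>A. ennreal (\<bar>u x\<bar> powr P x) \<partial>\<mu>)"
proof -
  have E: "{y. \<eta> < \<bar>u y\<bar>} \<inter> A \<in> sets \<mu>" using superlevel_sets[OF u] A by (rule sets.Int)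
  have "ennreal \<delta> * emeasure \<mu> ({y. \<eta> < \<bar>u y\<bar>} \<inter> A) = (\<integral>\<^sup>+x. ennreal \<delta> * indicator ({y. \<eta> < \<bar>u y\<bar>} \<inter> A) x \<partial>\<mu>)"
    using E by (simp add: nn_integral_cmult_indicator)
  also have "\<dots> \<le> (\<integral>\<^sup>+x\<in>A. ennreal (\<bar>u x\<bar> powr P x) \<partial>\<mu>)"
  proof (rule nn_integral_mono_AE, use AE_not_Z in eventually_elim)
    fix x assume x: "x \<notin> Z"
    show "ennreal \<delta> * indicator ({y. \<eta> < \<bar>u y\<bar>} \<inter> A) x \<le> ennreal (\<bar>u x\<bar> powr P x) * indicator A x"
    proof (cases "x \<in> {y. \<eta> < \<bar>u y\<bar>} \<inter> A")
      case True
      have "\<delta> \<le> \<eta> powr P x" by (rule \<delta>[OF x])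
      also have "\<dots> \<le> \<bar>u x\<bar> powr P x" using True \<eta> P_pos[OF x] by (intro powr_mono2) auto
      finally show ?thesis using True by (simp add: ennreal_leI)
    qed simp
  qed
  finally show ?thesis .
qed

lemma emeasure_superlevel_le:
  assumes u: "u \<in> borel_measurable \<mu>" and A: "A \<in> sets \<mu>" and \<eta>: "0 < \<eta>" "\<eta> \<le> 1"
    and I: "(\<integral>\<^sup>+x\<in>A. ennreal (\<bar>u x\<bar> powr P x) \<partial>\<mu>) \<le> ennreal (\<sigma> * \<eta> powr pM)" and \<sigma>: "0 \<le> \<sigma>"
  shows "emeasure \<mu> ({y. \<eta> < \<bar>u y\<bar>} \<inter> A) \<le> ennreal \<sigma>"
proof -
  have "ennreal (\<eta> powr pM) * emeasure \<mu> ({y. \<eta> < \<bar>u y\<bar>} \<inter> A) \<le> (\<integral>\<^sup>+x\<in>A. ennreal (\<bar>u x\<bar> powr P x) \<partial>\<mu>)"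
    using P_bounds \<eta> by (intro Chebyshev u A powr_mono') auto
  also have "\<dots> \<le> ennreal (\<eta> powr pM) * ennreal \<sigma>"
    using I \<sigma> by (simp add: mult.commute flip: ennreal_mult)
  finally show ?thesis using \<eta> by (subst (asm) ennreal_mult_le_mult_iff) auto
qed

lemma emeasure_high_superlevel_le:
  assumes u: "u \<in> borel_measurable \<mu>" and h: "0 < h" "h \<le> 1" and I: "modP u \<le> ennreal C"
  shows "emeasure \<mu> {y. 1 / h < \<bar>u y\<bar>} \<le> ennreal (h powr pm * C)"
proof -
  have "ennreal ((1 / h) powr pm) * emeasure \<mu> ({y. 1 / h < \<bar>u y\<bar>} \<inter> UNIV)
      \<le> (\<integral>\<^sup>+x\<in>UNIV. ennreal (\<bar>u x\<bar> powr P x) \<partial>\<mu>)"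
    using P_bounds h sets.top[of \<mu>] by (intro Chebyshev u powr_mono) auto
  also have "\<dots> \<le> ennreal C" using I by simp
  also have "\<dots> = ennreal ((1 / h) powr pm * (h powr pm * C))"
    using h by (simp add: powr_divide)
  also have "\<dots> = ennreal ((1 / h) powr pm) * ennreal (h powr pm * C)"
    by (rule ennreal_mult') auto
  finally show ?thesis using h by (subst (asm) ennreal_mult_le_mult_iff) auto
qed

text \<open>After scaling by \<open>\<theta>\<close> the \<open>P\<close>-modular is so small that Chebyshev's inequality provides smallness in measure.\<close>

lemma unit_ball_embedding:
  obtains \<theta> where "0 < \<theta>"
    "\<And>w g N. \<lbrakk>w \<in> borel_measurable \<mu>; modP w \<le> 1; g \<in> borel_measurable \<mu>; modP g \<le> 1;
      N \<in> null_sets \<mu>; gradient_off S w g N\<rbrakk> \<Longrightarrow> (\<integral>\<^sup>+x. ennreal (\<bar>\<theta> * w x\<bar> powr q x) \<partial>\<mu>) \<le> 1"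
proof -
  obtain \<eta> \<sigma> where \<eta>: "0 < \<eta>" "\<eta> \<le> 1" and \<sigma>: "0 < \<sigma>" and main:
    "\<And>w g N. \<lbrakk>w \<in> borel_measurable \<mu>; modP w \<le> ennreal 1; g \<in> borel_measurable \<mu>; modP g \<le> ennreal 1;
      N \<in> null_sets \<mu>; gradient_off S w g N;
      \<And>x. emeasure \<mu> ({y. \<eta> < \<bar>w y\<bar>} \<inter> ball x 1) \<le> ennreal \<sigma>\<rbrakk>
      \<Longrightarrow> (\<integral>\<^sup>+x. ennreal (\<bar>w x\<bar> powr q x) \<partial>\<mu>) \<le> ennreal 1"
    using small_modular_of_small_in_measure[of 1 1 1] by auto
  obtain \<theta> where \<theta>: "0 < \<theta>" "\<theta> \<le> 1" "\<theta> powr pm \<le> \<sigma> * \<eta> powr pM"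
  proof -
    obtain h where h: "0 < h" "h \<le> 1" "\<And>h'. 0 \<le> h' \<Longrightarrow> h' \<le> h \<Longrightarrow> h' powr pm * 1 \<le> \<sigma> * \<eta> powr pM"
      using small_powr[OF pos(1), of "\<sigma> * \<eta> powr pM" 1] \<sigma> \<eta> by auto
    show thesis using h(1,2) h(3)[of h] by (intro that[of h]) auto
  qed
  have shrink: "modP (\<lambda>x. \<theta> * u x) \<le> ennreal (\<theta> powr pm)" if "u \<in> borel_measurable \<mu>" "modP u \<le> 1" for u
  proof -
    have "modP (\<lambda>x. \<theta> * u x) \<le> ennreal (\<theta> powr pm) * modP u"
      using that \<theta> by (intro modP_shrink) auto
    also have "\<dots> \<le> ennreal (\<theta> powr pm) * 1" using that by (intro mult_left_mono) auto
    finally show ?thesis by simp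
  qed
  have \<theta>1: "ennreal (\<theta> powr pm) \<le> ennreal 1" using \<theta> pos by (intro ennreal_leI powr_le1) auto
  show thesis
  proof (rule that[OF \<theta>(1)])
    fix w g N
    assume w: "w \<in> borel_measurable \<mu>" "modP w \<le> 1" and g: "g \<in> borel_measurable \<mu>" "modP g \<le> 1"
      and N: "N \<in> null_sets \<mu>" and grad: "gradient_off S w g N"
    have grad': "gradient_off S (\<lambda>x. \<theta> * w x) (\<lambda>x. \<theta> * g x) N"
      using gradient_off_scale[OF grad] \<theta> by simp
    have "(\<integral>\<^sup>+x. ennreal (\<bar>\<theta> * w x\<bar> powr q x) \<partial>\<mu>) \<le> ennreal 1"
    proof (rule main[OF _ _ _ _ N grad'])
      fix x
      have "(\<integral>\<^sup>+y\<in>ball x 1. ennreal (\<bar>\<theta> * w y\<bar> powr P y) \<partial>\<mu>) \<le> modP (\<lambda>x. \<theta> * w x)"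
        by (intro nn_integral_mono) (auto simp: indicator_def)
      also have "\<dots> \<le> ennreal (\<theta> powr pm)" by (rule shrink[OF w])
      also have "\<dots> \<le> ennreal (\<sigma> * \<eta> powr pM)" using \<theta> by (intro ennreal_leI) auto
      finally show "emeasure \<mu> ({y. \<eta> < \<bar>\<theta> * w y\<bar>} \<inter> ball x 1) \<le> ennreal \<sigma>"
        using w \<eta> \<sigma> by (intro emeasure_superlevel_le) auto
    next
      show "modP (\<lambda>x. \<theta> * w x) \<le> ennreal 1" "modP (\<lambda>x. \<theta> * g x) \<le> ennreal 1"
        by (rule order.trans[OF shrink[OF w] \<theta>1], rule order.trans[OF shrink[OF g] \<theta>1])
    qed (use w g in auto)
    thus "(\<integral>\<^sup>+x. ennreal (\<bar>\<theta> * w x\<bar> powr q x) \<partial>\<mu>) \<le> 1" by simp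
  qed
qed

lemma translated_ball_integral:
  assumes h: "h \<in> Iso \<mu>" and P_inv: "\<And>x. P (h x) = P x" and w: "w \<in> borel_measurable \<mu>"
    and w_inv: "AE x in \<mu>. w (h x) = w x"
  shows "(\<integral>\<^sup>+y\<in>ball (h x) r. ennreal (\<bar>w y\<bar> powr P y) \<partial>\<mu>) = (\<integral>\<^sup>+y\<in>ball x r. ennreal (\<bar>w y\<bar> powr P y) \<partial>\<mu>)"
proof -
  have iso: "dist (h x) (h y) = dist x y" for x y using h by (simp add: Iso_def)
  have "continuous_on UNIV h" by (rule continuous_onI) (use iso in auto)
  hence h_meas: "h \<in> \<mu> \<rightarrow>\<^sub>M \<mu>"
    using borel_measurable_continuous_onI[of h] by (simp add: measurable_cong_sets[OF sets_eq sets_eq])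
  have "(\<integral>\<^sup>+y\<in>ball (h x) r. ennreal (\<bar>w y\<bar> powr P y) \<partial>\<mu>)
      = (\<integral>\<^sup>+y\<in>ball (h x) r. ennreal (\<bar>w y\<bar> powr P y) \<partial>distr \<mu> \<mu> h)"
    using h by (simp add: Iso_def)
  also have "\<dots> = (\<integral>\<^sup>+z. ennreal (\<bar>w (h z)\<bar> powr P (h z)) * indicator (ball (h x) r) (h z) \<partial>\<mu>)"
  proof -
    have "(\<lambda>y. ennreal (\<bar>w y\<bar> powr P y) * indicator (ball (h x) r) y) \<in> borel_measurable \<mu>"
      using w by (intro measurable_modular_integrand) auto
    thus ?thesis using h_meas by (simp add: nn_integral_distr)
  qed
  also have "\<dots> = (\<integral>\<^sup>+y\<in>ball x r. ennreal (\<bar>w y\<bar> powr P y) \<partial>\<mu>)"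
    by (rule nn_integral_cong_AE, use w_inv in eventually_elim) (auto simp: indicator_def iso P_inv)
  finally show ?thesis .
qed

text \<open>The orbit contains the centres of \<open>n\<close> disjoint balls, and measure-preserving isometries that leave \<open>w\<close> and \<open>P\<close>
  invariant carry the integral over \<open>ball x r\<close> to each of them.\<close>

lemma symmetric_decay:
  assumes H: "H \<subseteq> Iso \<mu>" and P_inv: "\<And>h x. h \<in> H \<Longrightarrow> P (h x) = P x" and w: "w \<in> borel_measurable \<mu>"
    and w_inv: "\<And>h. h \<in> H \<Longrightarrow> AE x in \<mu>. w (h x) = w x" and n: "enat n < orbit_packing H x r"
  shows "of_nat n * (\<integral>\<^sup>+y\<in>ball x r. ennreal (\<bar>w y\<bar> powr P y) \<partial>\<mu>) \<le> modP w"
proof -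
  define I where "I = (\<integral>\<^sup>+y\<in>ball x r. ennreal (\<bar>w y\<bar> powr P y) \<partial>\<mu>)"
  obtain A where A_in: "A \<in> {A. A \<subseteq> orbit_of H x \<and> (\<forall>\<xi>\<in>A. \<forall>\<eta>\<in>A. \<xi> \<noteq> \<eta> \<longrightarrow> ball \<xi> r \<inter> ball \<eta> r = {})}"
    and card: "enat n < (if finite A then enat (card A) else \<infinity>)"
    using n unfolding orbit_packing_def less_SUP_iff by (elim bexE)
  hence A: "A \<subseteq> orbit_of H x" "\<And>\<xi> \<eta>. \<xi> \<in> A \<Longrightarrow> \<eta> \<in> A \<Longrightarrow> \<xi> \<noteq> \<eta> \<Longrightarrow> ball \<xi> r \<inter> ball \<eta> r = {}"
    by auto
  obtain B where B: "B \<subseteq> A" "finite B" "card B = n"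
  proof (cases "finite A")
    case True
    hence "n \<le> card A" using card by simp
    then obtain B where "B \<subseteq> A" "card B = n" "finite B" by (rule obtain_subset_with_card_n)
    thus thesis by (intro that)
  next
    case False
    thus thesis using infinite_arbitrarily_large[of A n] that by blast
  qed
  have I: "(\<integral>\<^sup>+y\<in>ball \<xi> r. ennreal (\<bar>w y\<bar> powr P y) \<partial>\<mu>) = I" if \<xi>: "\<xi> \<in> B" for \<xi>
  proof -
    obtain h where h: "h \<in> H" "\<xi> = h x" using \<xi> B A by (auto simp: orbit_of_def)
    have "h \<in> Iso \<mu>" using h H by blast
    thus ?thesis unfolding I_def h(2)
      by (rule translated_ball_integral[OF _ P_inv[OF h(1)] w w_inv[OF h(1)]])
  qed
  have "of_nat n * I = (\<Sum>\<xi>\<in>B. \<integral>\<^sup>+y\<in>ball \<xi> r. ennreal (\<bar>w y\<bar> powr P y) \<partial>\<mu>)" using I B by simp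
  also have "\<dots> = (\<integral>\<^sup>+y. (\<Sum>\<xi>\<in>B. ennreal (\<bar>w y\<bar> powr P y) * indicator (ball \<xi> r) y) \<partial>\<mu>)"
    using w by (intro nn_integral_sum[symmetric] measurable_modular_integrand) auto
  also have "\<dots> = (\<integral>\<^sup>+y. ennreal (\<bar>w y\<bar> powr P y) * indicator (\<Union>\<xi>\<in>B. ball \<xi> r) y \<partial>\<mu>)"
  proof (intro nn_integral_cong)
    fix y
    have "disjoint_family_on (\<lambda>\<xi>. ball \<xi> r) B" using A(2) B by (auto simp: disjoint_family_on_def)
    thus "(\<Sum>\<xi>\<in>B. ennreal (\<bar>w y\<bar> powr P y) * indicator (ball \<xi> r) y)
        = ennreal (\<bar>w y\<bar> powr P y) * indicator (\<Union>\<xi>\<in>B. ball \<xi> r) y"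
      using B(2) by (simp add: indicator_UN_disjoint sum_distrib_left)
  qed
  also have "\<dots> \<le> modP w" by (intro nn_integral_mono) (auto simp: indicator_def)
  finally show ?thesis by (simp add: I_def)
qed

text \<open>Outside the set \<open>bad u\<close>, both \<open>u\<close> and its gradient are at most \<open>K\<close>, so \<open>u\<close> has small oscillation on balls of radius
  \<open>\<tau>\<close>. The class of \<open>u\<close> records, for each ball of a finite cover, the rounded value of \<open>u\<close> at some point that is not bad;
  two functions in the same class are uniformly close off the union of their bad sets.\<close>

lemma finite_classes_in_measure:
  assumes \<eta>: "0 < \<eta>" and \<sigma>: "0 < \<sigma>" and C: "0 \<le> C"
    and F: "\<And>u. u \<in> F \<Longrightarrow> u \<in> borel_measurable \<mu> \<and> modP u \<le> ennreal C"
      "\<And>u. u \<in> F \<Longrightarrow> \<exists>g N. g \<in> borel_measurable \<mu> \<and> modP g \<le> ennreal C \<and> N \<in> null_sets \<mu> \<and> gradient_off S u g N"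
  obtains \<phi> :: "('a \<Rightarrow> real) \<Rightarrow> 'a \<Rightarrow> int" where "finite (\<phi> ` F)"
    "\<And>u v. u \<in> F \<Longrightarrow> v \<in> F \<Longrightarrow> \<phi> u = \<phi> v \<Longrightarrow>
      emeasure \<mu> ({y. \<eta> < \<bar>u y - v y\<bar>} \<inter> ball x0 R) \<le> ennreal \<sigma>"
proof -
  obtain g N where g: "\<And>u. u \<in> F \<Longrightarrow> g u \<in> borel_measurable \<mu>" "\<And>u. u \<in> F \<Longrightarrow> modP (g u) \<le> ennreal C"
      "\<And>u. u \<in> F \<Longrightarrow> N u \<in> null_sets \<mu>" "\<And>u. u \<in> F \<Longrightarrow> gradient_off S u (g u) (N u)"
    using F(2) by metis
  obtain h where h: "0 < h" "h \<le> 1" "h powr pm * C \<le> \<sigma> / 4"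
  proof -
    obtain h where h: "0 < h" "h \<le> 1" "\<And>h'. 0 \<le> h' \<Longrightarrow> h' \<le> h \<Longrightarrow> h' powr pm * C \<le> \<sigma> / 4"
      using small_powr[OF pos(1), of "\<sigma> / 4" C] \<sigma> C by auto
    show thesis using h(1,2) h(3)[of h] by (intro that[of h]) auto
  qed
  define K where "K = 1 / h"
  have K: "0 < K" using h by (simp add: K_def)
  obtain \<tau>2 where \<tau>2: "0 < \<tau>2" "\<tau>2 \<le> 1" "\<tau>2 powr sm * (2 * K) \<le> \<eta> / 4"
  proof -
    obtain h where h: "0 < h" "h \<le> 1" "\<And>h'. 0 \<le> h' \<Longrightarrow> h' \<le> h \<Longrightarrow> h' powr sm * (2 * K) \<le> \<eta> / 4"
      using small_powr[OF pos(2), of "\<eta> / 4" "2 * K"] \<eta> K by auto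
    show thesis using h(1,2) h(3)[of h] by (intro that[of h]) auto
  qed
  define \<tau> where "\<tau> = \<tau>2 / 2"
  have \<tau>: "0 < \<tau>" using \<tau>2 by (simp add: \<tau>_def)
  obtain A where A: "finite A" "ball x0 R \<subseteq> (\<Union>a\<in>A. ball a \<tau>)"
    using doubling_finite_cover[OF doubling \<tau>] by blast
  define bad where "bad = (\<lambda>u. {y. K < \<bar>u y\<bar>} \<union> {y. K < \<bar>g u y\<bar>} \<union> (N u \<union> Z))"
  have bad_sets: "bad u \<in> sets \<mu>" if "u \<in> F" for u
    unfolding bad_def using that F(1) g(1) null_setsD2[OF g(3)] null_setsD2[OF Z]
    by (intro sets.Un superlevel_sets) auto
  have bad_small: "emeasure \<mu> (bad u) \<le> ennreal (\<sigma> / 2)" if u: "u \<in> F" for u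
  proof -
    have NZ: "N u \<union> Z \<in> null_sets \<mu>" using g(3)[OF u] Z by auto
    have "emeasure \<mu> (bad u) \<le> emeasure \<mu> ({y. K < \<bar>u y\<bar>} \<union> {y. K < \<bar>g u y\<bar>})"
      unfolding bad_def using F(1)[OF u] g(1)[OF u] NZ
      by (subst emeasure_Un_null_set) (auto intro!: superlevel_sets)
    also have "\<dots> \<le> emeasure \<mu> {y. K < \<bar>u y\<bar>} + emeasure \<mu> {y. K < \<bar>g u y\<bar>}"
      using F(1)[OF u] g(1)[OF u] by (intro emeasure_subadditive superlevel_sets) auto
    also have "\<dots> \<le> ennreal (h powr pm * C) + ennreal (h powr pm * C)"
      unfolding K_def using F(1)[OF u] g(1,2)[OF u] h by (intro add_mono emeasure_high_superlevel_le) auto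
    also have "\<dots> \<le> ennreal (\<sigma> / 4) + ennreal (\<sigma> / 4)" using h by (intro add_mono ennreal_leI) auto
    also have "\<dots> = ennreal (\<sigma> / 2)" using \<sigma> by (simp flip: ennreal_plus)
    finally show ?thesis .
  qed
  have osc: "\<bar>u z - u y\<bar> \<le> \<eta> / 4"
    if u: "u \<in> F" and z: "z \<in> ball a \<tau>" "z \<notin> bad u" and y: "y \<in> ball a \<tau>" "y \<notin> bad u" for u a y z
  proof -
    have d: "dist z y \<le> \<tau>2" using z(1) y(1) dist_triangle3[of z y a] by (simp add: \<tau>_def)
    have nn: "\<And>x. 0 \<le> g u x" using g(4)[OF u] by (simp add: gradient_off_def)
    have le: "dist z y powr S x * g u x \<le> \<tau>2 powr sm * K" if x: "x \<notin> bad u" for x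
    proof (intro mult_mono)
      have xZ: "x \<notin> Z" using x by (simp add: bad_def)
      have "dist z y powr S x \<le> \<tau>2 powr S x" using d S_pos[OF xZ] by (intro powr_mono2) auto
      also have "\<dots> \<le> \<tau>2 powr sm" using \<tau>2 S_bounds[OF xZ] by (intro powr_mono') auto
      finally show "dist z y powr S x \<le> \<tau>2 powr sm" .
      show "g u x \<le> K" using x nn[of x] by (auto simp: bad_def)
    qed (use nn in auto)
    have zy: "z \<in> - N u" "y \<in> - N u" using z(2) y(2) by (auto simp: bad_def)
    have "\<bar>u z - u y\<bar> \<le> dist z y powr S z * g u z + dist z y powr S y * g u y"
      using g(4)[OF u] zy unfolding gradient_off_def by blast
    also have "\<dots> \<le> \<tau>2 powr sm * K + \<tau>2 powr sm * K" using z(2) y(2) by (intro add_mono le)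
    also have "\<dots> = \<tau>2 powr sm * (2 * K)" by simp
    also have "\<dots> \<le> \<eta> / 4" by (rule \<tau>2)
    finally show ?thesis .
  qed
  define pt where "pt = (\<lambda>u a. SOME y. y \<in> ball a \<tau> \<and> y \<notin> bad u)"
  have pt: "pt u a \<in> ball a \<tau> \<and> pt u a \<notin> bad u" if "y \<in> ball a \<tau>" "y \<notin> bad u" for u a y
    unfolding pt_def using that by (rule_tac someI) blast
  define \<phi> where "\<phi> = (\<lambda>u a. if a \<in> A \<and> pt u a \<notin> bad u then \<lfloor>u (pt u a) / (\<eta> / 2)\<rfloor> else 0)"
  show thesis
  proof (rule that[of \<phi>])
    define m where "m = \<lceil>K / (\<eta> / 2)\<rceil> + 1"
    have "\<phi> u a \<in> {- m..m}" for u a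
    proof (cases "a \<in> A \<and> pt u a \<notin> bad u")
      case True
      hence "\<bar>u (pt u a)\<bar> \<le> K" by (auto simp: bad_def)
      hence "- K \<le> u (pt u a)" "u (pt u a) \<le> K" by auto
      hence "(- K) / (\<eta> / 2) \<le> u (pt u a) / (\<eta> / 2)" "u (pt u a) / (\<eta> / 2) \<le> K / (\<eta> / 2)"
        using \<eta> by (intro divide_right_mono; simp)+
      hence "- m \<le> \<lfloor>u (pt u a) / (\<eta> / 2)\<rfloor>" "\<lfloor>u (pt u a) / (\<eta> / 2)\<rfloor> \<le> m"
        unfolding m_def minus_divide_left[symmetric] by linarith+
      thus ?thesis using True by (simp add: \<phi>_def)
    next
      case False
      have "0 \<le> K / (\<eta> / 2)" using K \<eta> by simp
      hence "0 \<le> m" unfolding m_def by linarith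
      thus ?thesis using False by (auto simp: \<phi>_def)
    qed
    hence "\<phi> ` F \<subseteq> {f. \<forall>a. (a \<in> A \<longrightarrow> f a \<in> {- m..m}) \<and> (a \<notin> A \<longrightarrow> f a = 0)}"
      by (auto simp: \<phi>_def)
    thus "finite (\<phi> ` F)" by (rule finite_subset) (intro finite_set_of_finite_funs A(1) finite_atLeastAtMost_int)
  next
    fix u v assume u: "u \<in> F" and v: "v \<in> F" and eq: "\<phi> u = \<phi> v"
    have "{y. \<eta> < \<bar>u y - v y\<bar>} \<inter> ball x0 R \<subseteq> bad u \<union> bad v"
    proof (rule subsetI, rule ccontr)
      fix z assume z: "z \<in> {y. \<eta> < \<bar>u y - v y\<bar>} \<inter> ball x0 R" and "z \<notin> bad u \<union> bad v"
      hence zb: "z \<notin> bad u" "z \<notin> bad v" by auto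
      obtain a where a: "a \<in> A" "z \<in> ball a \<tau>" using A(2) z by blast
      note pu = pt[OF a(2) zb(1)] and pv = pt[OF a(2) zb(2)]
      have "\<lfloor>u (pt u a) / (\<eta> / 2)\<rfloor> = \<lfloor>v (pt v a) / (\<eta> / 2)\<rfloor>"
        using fun_cong[OF eq, of a] a pu pv by (simp add: \<phi>_def)
      hence "\<bar>u (pt u a) - v (pt v a)\<bar> < \<eta> / 2" using \<eta> by (intro floor_divide_eq_imp_close) auto
      moreover have "\<bar>u z - u (pt u a)\<bar> \<le> \<eta> / 4" using osc[OF u a(2) zb(1)] pu by blast
      moreover have "\<bar>v z - v (pt v a)\<bar> \<le> \<eta> / 4" using osc[OF v a(2) zb(2)] pv by blast
      ultimately have "\<bar>u z - v z\<bar> < 2 * (\<eta> / 4) + \<eta> / 2" by (intro abs_diff_less_of_close)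
      thus False using z by simp
    qed
    hence "emeasure \<mu> ({y. \<eta> < \<bar>u y - v y\<bar>} \<inter> ball x0 R) \<le> emeasure \<mu> (bad u \<union> bad v)"
      using bad_sets u v by (intro emeasure_mono) auto
    also have "\<dots> \<le> emeasure \<mu> (bad u) + emeasure \<mu> (bad v)"
      using bad_sets u v by (intro emeasure_subadditive)
    also have "\<dots> \<le> ennreal (\<sigma> / 2) + ennreal (\<sigma> / 2)" using bad_small u v by (intro add_mono)
    also have "\<dots> = ennreal \<sigma>" using \<sigma> by (simp flip: ennreal_plus)
    finally show "emeasure \<mu> ({y. \<eta> < \<bar>u y - v y\<bar>} \<inter> ball x0 R) \<le> ennreal \<sigma>" .
  qed
qed

text \<open>The classes come from \<open>finite_classes_in_measure\<close> on a ball large enough that every ball centred outside \<open>ball x0 R\<close> has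
  more than \<open>n\<close> disjoint copies, and \<open>n\<close> is chosen so that Chebyshev's inequality gives the measure bound \<open>\<sigma>\<close> there.\<close>

lemma finite_classes_in_modular:
  assumes H: "H \<subseteq> Iso \<mu>" and P_inv: "\<And>h x. h \<in> H \<Longrightarrow> P (h x) = P x"
    and r: "0 < r" and packing: "((\<lambda>R::real. INF x\<in>UNIV - ball x0 R. orbit_packing H x r) \<longlongrightarrow> \<infinity>) at_top"
    and k: "0 < k"
    and F: "\<And>u. u \<in> F \<Longrightarrow> u \<in> borel_measurable \<mu> \<and> modP u \<le> 1"
      "\<And>u. u \<in> F \<Longrightarrow> \<exists>g N. g \<in> borel_measurable \<mu> \<and> modP g \<le> 1 \<and> N \<in> null_sets \<mu> \<and> gradient_off S u g N"
    and F_inv: "\<And>u h. u \<in> F \<Longrightarrow> h \<in> H \<Longrightarrow> AE x in \<mu>. u (h x) = u x"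
  obtains \<phi> :: "('a \<Rightarrow> real) \<Rightarrow> 'a \<Rightarrow> int" where "finite (\<phi> ` F)"
    "\<And>u v. u \<in> F \<Longrightarrow> v \<in> F \<Longrightarrow> \<phi> u = \<phi> v \<Longrightarrow>
      (\<integral>\<^sup>+x. ennreal (\<bar>k * (u x - v x)\<bar> powr q x) \<partial>\<mu>) \<le> 1"
proof -
  define C where "C = max 1 k powr pM * (2 powr pM * 2)"
  have "1 * (1 * 1) \<le> C" unfolding C_def using pM_pos by (intro mult_mono ge_one_powr_ge_zero) auto
  hence C: "1 \<le> C" by simp
  have C_bound: "modP (\<lambda>x. k * f x) \<le> ennreal C"
    if "f \<in> borel_measurable \<mu>" "u \<in> borel_measurable \<mu>" "v \<in> borel_measurable \<mu>" "\<And>x. \<bar>f x\<bar> \<le> \<bar>u x\<bar> + \<bar>v x\<bar>"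
      "modP u \<le> 1" "modP v \<le> 1" for f u v
  proof -
    have "modP (\<lambda>x. k * f x) \<le> ennreal (max 1 k powr pM) * modP f" using that k by (intro modP_stretch) auto
    also have "\<dots> \<le> ennreal (max 1 k powr pM) * (ennreal (2 powr pM) * (modP u + modP v))"
      using that by (intro mult_left_mono modP_add) auto
    also have "\<dots> \<le> ennreal (max 1 k powr pM) * (ennreal (2 powr pM) * (1 + 1))"
      using that by (intro mult_left_mono add_mono) auto
    also have "\<dots> = ennreal C" unfolding C_def by (simp add: ennreal_mult)
    finally show ?thesis .
  qed
  \<comment> \<open>Lower regularity concerns radii up to \<open>1\<close>, while \<open>r\<close> is arbitrary.\<close>
  define \<rho> where "\<rho> = min r 1"
  have \<rho>: "0 < \<rho>" "\<rho> \<le> 1" "\<rho> \<le> r" using r by (auto simp: \<rho>_def)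
  obtain \<eta> \<sigma> where \<eta>: "0 < \<eta>" "\<eta> \<le> 1" and \<sigma>: "0 < \<sigma>" and main:
    "\<And>w g N. \<lbrakk>w \<in> borel_measurable \<mu>; modP w \<le> ennreal C; g \<in> borel_measurable \<mu>; modP g \<le> ennreal C;
      N \<in> null_sets \<mu>; gradient_off S w g N;
      \<And>x. emeasure \<mu> ({y. \<eta> < \<bar>w y\<bar>} \<inter> ball x \<rho>) \<le> ennreal \<sigma>\<rbrakk>
      \<Longrightarrow> (\<integral>\<^sup>+x. ennreal (\<bar>w x\<bar> powr q x) \<partial>\<mu>) \<le> ennreal 1"
    using small_modular_of_small_in_measure[OF C \<rho>(1,2), of 1] by auto
  have \<sigma>\<eta>: "0 < \<sigma> * \<eta> powr pM" using \<sigma> \<eta> by simp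
  obtain n :: nat where n: "C / (\<sigma> * \<eta> powr pM) < real n" using reals_Archimedean2 by blast
  moreover have "0 < C / (\<sigma> * \<eta> powr pM)" using \<sigma>\<eta> C by simp
  ultimately have n0: "0 < real n" by linarith
  have Cn: "C / real n \<le> \<sigma> * \<eta> powr pM" using n n0 \<sigma>\<eta> by (simp add: field_simps)
  have "eventually (\<lambda>R::real. enat n < (INF x\<in>UNIV - ball x0 R. orbit_packing H x r)) at_top"
    by (rule order_tendstoD(1)[OF packing]) simp
  then obtain R :: real where R: "enat n < (INF x\<in>UNIV - ball x0 R. orbit_packing H x r)"
    by (auto simp: eventually_at_top_linorder)
  have far: "enat n < orbit_packing H x r" if "x \<notin> ball x0 R" for x
    using R that by (intro order.strict_trans2[OF R INF_lower]) auto
  have \<eta>k: "0 < \<eta> / k" using \<eta> k by simp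
  obtain \<phi> :: "('a \<Rightarrow> real) \<Rightarrow> 'a \<Rightarrow> int" where \<phi>: "finite (\<phi> ` F)" and near:
    "\<And>u v. u \<in> F \<Longrightarrow> v \<in> F \<Longrightarrow> \<phi> u = \<phi> v \<Longrightarrow>
      emeasure \<mu> ({y. \<eta> / k < \<bar>u y - v y\<bar>} \<inter> ball x0 (R + 1)) \<le> ennreal \<sigma>"
    using finite_classes_in_measure[OF \<eta>k \<sigma>, of 1 F x0 "R + 1"] F by auto
  show thesis
  proof (rule that[OF \<phi>])
    fix u v assume u: "u \<in> F" and v: "v \<in> F" and eq: "\<phi> u = \<phi> v"
    obtain g N where g: "g \<in> borel_measurable \<mu>" "modP g \<le> 1" "N \<in> null_sets \<mu>" "gradient_off S u g N"
      using F(2)[OF u] by blast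
    obtain g' N' where g': "g' \<in> borel_measurable \<mu>" "modP g' \<le> 1" "N' \<in> null_sets \<mu>" "gradient_off S v g' N'"
      using F(2)[OF v] by blast
    define w where "w = (\<lambda>x. k * (u x - v x))"
    have meas [measurable]: "u \<in> borel_measurable \<mu>" "v \<in> borel_measurable \<mu>" "g \<in> borel_measurable \<mu>" "g' \<in> borel_measurable \<mu>"
      using F(1) u v g g' by auto
    have w [measurable]: "w \<in> borel_measurable \<mu>" unfolding w_def by measurable
    have wC: "modP w \<le> ennreal C"
      unfolding w_def using F(1) u v by (intro C_bound[of _ u v]) auto
    have gC: "modP (\<lambda>x. k * (g x + g' x)) \<le> ennreal C"
      using g g' by (intro C_bound[of _ g g']) auto
    have grad: "gradient_off S w (\<lambda>x. k * (g x + g' x)) (N \<union> N')"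
      unfolding w_def using gradient_off_scale[OF gradient_off_diff[OF g(4) g'(4)], of k] k by simp
    have "(\<integral>\<^sup>+x. ennreal (\<bar>w x\<bar> powr q x) \<partial>\<mu>) \<le> ennreal 1"
    proof (rule main[OF w wC _ gC _ grad])
      fix x
      show "emeasure \<mu> ({y. \<eta> < \<bar>w y\<bar>} \<inter> ball x \<rho>) \<le> ennreal \<sigma>"
      proof (cases "x \<in> ball x0 R")
        case True
        have "ball x \<rho> \<subseteq> ball x0 (R + 1)"
        proof
          fix y assume "y \<in> ball x \<rho>"
          thus "y \<in> ball x0 (R + 1)" using True \<rho> dist_triangle[of x0 y x] by auto
        qed
        moreover have "{y. \<eta> < \<bar>w y\<bar>} = {y. \<eta> / k < \<bar>u y - v y\<bar>}"
          using k by (simp add: w_def abs_mult pos_divide_less_eq mult.commute)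
        ultimately have "emeasure \<mu> ({y. \<eta> < \<bar>w y\<bar>} \<inter> ball x \<rho>) \<le> emeasure \<mu> ({y. \<eta> / k < \<bar>u y - v y\<bar>} \<inter> ball x0 (R + 1))"
          using superlevel_sets[of "\<lambda>y. u y - v y" "\<eta> / k"] by (intro emeasure_mono) (auto intro!: sets.Int)
        also have "\<dots> \<le> ennreal \<sigma>" by (rule near[OF u v eq])
        finally show ?thesis .
      next
        case False
        have w_inv: "AE x in \<mu>. w (h x) = w x" if h: "h \<in> H" for h
          using F_inv[OF u h] F_inv[OF v h] by eventually_elim (simp add: w_def)
        have "of_nat n * (\<integral>\<^sup>+y\<in>ball x r. ennreal (\<bar>w y\<bar> powr P y) \<partial>\<mu>) \<le> modP w"
          by (rule symmetric_decay[where H = H]) (rule H P_inv w w_inv far[OF False] | assumption)+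
        also have "\<dots> \<le> ennreal (real n * (C / real n))" using wC n0 by simp
        also have "\<dots> \<le> ennreal (real n * (\<sigma> * \<eta> powr pM))"
          using Cn n0 by (intro ennreal_leI mult_left_mono) auto
        also have "\<dots> = of_nat n * ennreal (\<sigma> * \<eta> powr pM)"
          by (simp add: ennreal_mult' ennreal_of_nat_eq_real_of_nat)
        finally have I: "(\<integral>\<^sup>+y\<in>ball x r. ennreal (\<bar>w y\<bar> powr P y) \<partial>\<mu>) \<le> ennreal (\<sigma> * \<eta> powr pM)"
          using n0 by (subst (asm) ennreal_mult_le_mult_iff) auto
        have "emeasure \<mu> ({y. \<eta> < \<bar>w y\<bar>} \<inter> ball x \<rho>) \<le> emeasure \<mu> ({y. \<eta> < \<bar>w y\<bar>} \<inter> ball x r)"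
          using superlevel_sets[OF w] subset_ball[OF \<rho>(3), of x] by (intro emeasure_mono) (auto intro!: sets.Int)
        also have "\<dots> \<le> ennreal \<sigma>" using \<sigma> by (intro emeasure_superlevel_le w \<eta> I) auto
        finally show ?thesis .
      qed
    qed (use g g' in auto)
    thus "(\<integral>\<^sup>+x. ennreal (\<bar>k * (u x - v x)\<bar> powr q x) \<partial>\<mu>) \<le> 1" by (simp add: w_def)
  qed
qed

end

section \<open>Extended real exponents and quasi-norms\<close>

lemma essinf_pos_bound:
  assumes "0 < essinf M f"
  shows "\<exists>d>0. AE x in M. ereal d \<le> f x"
proof -
  obtain z where z: "AE x in M. z \<le> f x" "0 < z" using assms unfolding essinf_def less_Sup_iff by blast
  obtain d where d: "0 < ereal d" "ereal d < z" using ereal_dense2[OF z(2)] by blast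
  show ?thesis
  proof (intro exI[of _ d] conjI)
    show "AE x in M. ereal d \<le> f x" using z(1) by eventually_elim (use d in auto)
  qed (use d in auto)
qed

lemma bounded_exponent_bounds:
  assumes "p \<in> bounded_exponents M"
  shows "\<exists>m B. 0 < m \<and> (AE x in M. ereal m \<le> p x \<and> p x \<le> ereal B)"
proof -
  have p: "p \<in> borel_measurable M" "\<And>x. 0 < p x" "0 < essinf M p" and sup: "esssup M (\<lambda>x. \<bar>p x\<bar>) < \<infinity>"
    using assms by (auto simp: bounded_exponents_def exponents_def)
  obtain m where m: "0 < m" "AE x in M. ereal m \<le> p x" using essinf_pos_bound[OF p(3)] by blast
  obtain B where B: "esssup M (\<lambda>x. \<bar>p x\<bar>) < ereal B" using ereal_dense2[OF sup] by blast
  have "AE x in M. \<bar>p x\<bar> \<le> esssup M (\<lambda>x. \<bar>p x\<bar>)" by (rule esssup_AE)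
  hence "AE x in M. ereal m \<le> p x \<and> p x \<le> ereal B"
    using m(2)
  proof eventually_elim
    case (elim x)
    have "\<bar>p x\<bar> = p x" using p(2)[of x] by (simp add: abs_ereal_pos)
    thus ?case using elim B by auto
  qed
  thus ?thesis using m(1) by blast
qed

lemma real_log_Hoelder:
  assumes "\<bar>1 / p x - 1 / p y\<bar> \<le> ereal (C / ln (exp 1 + 1 / dist x y))" "C \<le> L"
    and "p x = ereal a" "p y = ereal a'" "0 < a" "0 < a'"
  shows "\<bar>1 / a - 1 / a'\<bar> \<le> L / ln (exp 1 + 1 / dist x (y::'a::metric_space))"
proof -
  have "ln (exp 1) \<le> ln (exp 1 + 1 / dist x y)" by (intro ln_mono) (auto intro: add_pos_nonneg)
  hence pos: "0 < ln (exp 1 + 1 / dist x y)" by simp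
  have "1 / p x = ereal (1 / a)" "1 / p y = ereal (1 / a')" using assms by (auto simp: one_ereal_def)
  hence "\<bar>1 / a - 1 / a'\<bar> \<le> C / ln (exp 1 + 1 / dist x y)" using assms(1) by simp
  also have "\<dots> \<le> L / ln (exp 1 + 1 / dist x y)" using pos assms(2) by (intro divide_right_mono) auto
  finally show ?thesis .
qed

text \<open>All almost everywhere bounds on the exponents hold off one common null set; outside it the exponents are finite and the operations on
  extended reals reduce to those on reals.\<close>

lemma subcritical_exponents_of_ereal:
  assumes mms: "metric_measure_space \<mu>" and dbl: "geometrically_doubling TYPE('a::metric_space)"
    and Q: "Q \<in> log_exponents (\<mu> :: 'a measure)" and lower: "lower_Ahlfors_regular \<mu> Q"
    and p: "p \<in> log_exponents \<mu>" and s: "s \<in> log_exponents \<mu>"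
    and sp: "exponent_much_less \<mu> (\<lambda>x. s x * p x) Q"
    and q: "q \<in> bounded_exponents \<mu>" "exponent_much_less \<mu> p q"
      "exponent_much_less \<mu> q (\<lambda>x. Q x * p x / (Q x - s x * p x))"
  obtains Z pm pM sm sM QM c b L where
    "subcritical_exponents \<mu> (\<lambda>x. real_of_ereal (p x)) (\<lambda>x. real_of_ereal (s x)) (\<lambda>x. real_of_ereal (Q x))
       (\<lambda>x. real_of_ereal (q x)) Z pm pM sm sM QM c b L"
proof -
  have bdd: "p \<in> bounded_exponents \<mu>" "s \<in> bounded_exponents \<mu>" "Q \<in> bounded_exponents \<mu>"
    using p s Q by (auto simp: log_exponents_def)
  obtain pm pM where pm: "0 < pm" "AE x in \<mu>. ereal pm \<le> p x \<and> p x \<le> ereal pM"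
    using bounded_exponent_bounds[OF bdd(1)] by blast
  obtain sm sM where sm: "0 < sm" "AE x in \<mu>. ereal sm \<le> s x \<and> s x \<le> ereal sM"
    using bounded_exponent_bounds[OF bdd(2)] by blast
  obtain Qm QM where Qm: "0 < Qm" "AE x in \<mu>. ereal Qm \<le> Q x \<and> Q x \<le> ereal QM"
    using bounded_exponent_bounds[OF bdd(3)] by blast
  obtain qm qM where qm: "0 < qm" "AE x in \<mu>. ereal qm \<le> q x \<and> q x \<le> ereal qM"
    using bounded_exponent_bounds[OF q(1)] by blast
  obtain c1 where c1: "0 < c1" "AE x in \<mu>. ereal c1 \<le> Q x - s x * p x"
    using essinf_pos_bound sp unfolding exponent_much_less_def by blast
  obtain c2 where c2: "0 < c2" "AE x in \<mu>. ereal c2 \<le> q x - p x"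
    using essinf_pos_bound q(2) unfolding exponent_much_less_def by blast
  obtain c3 where c3: "0 < c3" "AE x in \<mu>. ereal c3 \<le> Q x * p x / (Q x - s x * p x) - q x"
    using essinf_pos_bound q(3) unfolding exponent_much_less_def by blast
  obtain b where b: "0 < b" "\<And>x t. t \<in> {0<..1} \<Longrightarrow> ennreal (b * t powr real_of_ereal (Q x)) \<le> emeasure \<mu> (ball x t)"
    using lower unfolding lower_Ahlfors_regular_def by blast
  obtain Cp where Cp: "0 < Cp" "\<And>x y. \<bar>1 / p x - 1 / p y\<bar> \<le> ereal (Cp / ln (exp 1 + 1 / dist x y))"
    using p unfolding log_exponents_def by blast
  obtain Cs where Cs: "0 < Cs" "\<And>x y. \<bar>1 / s x - 1 / s y\<bar> \<le> ereal (Cs / ln (exp 1 + 1 / dist x y))"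
    using s unfolding log_exponents_def by blast
  define c where "c = min c1 (min c2 c3)"
  define P S Qr qr where "P = (\<lambda>x. real_of_ereal (p x))" and "S = (\<lambda>x. real_of_ereal (s x))"
    and "Qr = (\<lambda>x. real_of_ereal (Q x))" and "qr = (\<lambda>x. real_of_ereal (q x))"
  have "AE x in \<mu>. (p x = ereal (P x) \<and> pm \<le> P x \<and> P x \<le> pM) \<and> (s x = ereal (S x) \<and> sm \<le> S x \<and> S x \<le> sM)
      \<and> Qr x \<le> QM \<and> S x * P x + c \<le> Qr x \<and> P x + c \<le> qr x \<and> qr x + c \<le> Qr x * P x / (Qr x - S x * P x)"
    using pm(2) sm(2) Qm(2) qm(2) c1(2) c2(2) c3(2)
  proof eventually_elim
    case (elim x)
    have real: "y = ereal (real_of_ereal y) \<and> m \<le> real_of_ereal y \<and> real_of_ereal y \<le> B"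
      if "ereal m \<le> y \<and> y \<le> ereal B" for m B y
      using that by (cases y) auto
    have P: "p x = ereal (P x) \<and> pm \<le> P x \<and> P x \<le> pM" unfolding P_def by (rule real[OF elim(1)])
    have S: "s x = ereal (S x) \<and> sm \<le> S x \<and> S x \<le> sM" unfolding S_def by (rule real[OF elim(2)])
    have Qx: "Q x = ereal (Qr x) \<and> Qm \<le> Qr x \<and> Qr x \<le> QM" unfolding Qr_def by (rule real[OF elim(3)])
    have qx: "q x = ereal (qr x) \<and> qm \<le> qr x \<and> qr x \<le> qM" unfolding qr_def by (rule real[OF elim(4)])
    have p': "p x = ereal (P x)" and s': "s x = ereal (S x)" and Q': "Q x = ereal (Qr x)" and q': "q x = ereal (qr x)"
      using P S Qx qx by blast+
    have 1: "c1 \<le> Qr x - S x * P x" using elim(5) by (simp add: p' s' Q')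
    hence "Q x * p x / (Q x - s x * p x) = ereal (Qr x * P x / (Qr x - S x * P x))"
      using c1(1) by (simp add: p' s' Q')
    hence 3: "c3 \<le> Qr x * P x / (Qr x - S x * P x) - qr x" using elim(7) by (simp add: q')
    have 2: "c2 \<le> qr x - P x" using elim(6) by (simp add: p' q')
    have "c \<le> c1" "c \<le> c2" "c \<le> c3" by (auto simp: c_def)
    hence "S x * P x + c \<le> Qr x" "P x + c \<le> qr x" "qr x + c \<le> Qr x * P x / (Qr x - S x * P x)"
      using 1 2 3 by linarith+
    thus ?case using P S Qx by blast
  qed
  then obtain Z where Z: "Z \<in> null_sets \<mu>" and out: "\<And>x. x \<in> space \<mu> \<Longrightarrow> x \<notin> Z \<Longrightarrow>
      (p x = ereal (P x) \<and> pm \<le> P x \<and> P x \<le> pM) \<and> (s x = ereal (S x) \<and> sm \<le> S x \<and> S x \<le> sM)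
      \<and> Qr x \<le> QM \<and> S x * P x + c \<le> Qr x \<and> P x + c \<le> qr x \<and> qr x + c \<le> Qr x * P x / (Qr x - S x * P x)"
    unfolding eventually_ae_filter by blast
  have sp: "space \<mu> = UNIV" using mms by (auto simp: metric_measure_space_def dest: sets_eq_imp_space_eq)
  have "subcritical_exponents \<mu> P S Qr qr Z pm pM sm sM QM c b (max Cp Cs)"
  proof
    have "p \<in> borel_measurable \<mu>" "q \<in> borel_measurable \<mu>"
      using bdd(1) q(1) by (auto simp: bounded_exponents_def exponents_def)
    thus "P \<in> borel_measurable \<mu>" "qr \<in> borel_measurable \<mu>" unfolding P_def qr_def by measurable
  next
    fix x y assume xy: "x \<notin> Z" "y \<notin> Z"
    show "\<bar>1 / P x - 1 / P y\<bar> \<le> max Cp Cs / ln (exp 1 + 1 / dist x y)"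
      using out[of x] out[of y] xy sp pm(1) by (intro real_log_Hoelder[OF Cp(2)]) auto
    show "\<bar>1 / S x - 1 / S y\<bar> \<le> max Cp Cs / ln (exp 1 + 1 / dist x y)"
      using out[of x] out[of y] xy sp sm(1) by (intro real_log_Hoelder[OF Cs(2)]) auto
  qed (use mms dbl Z pm(1) sm(1) c1(1) c2(1) c3(1) b Cp(1) out sp in \<open>auto simp: c_def Qr_def\<close>)
  thus thesis unfolding P_def S_def Qr_def qr_def by (rule that)
qed

lemma Lebesgue_norm_le:
  "0 < l \<Longrightarrow> modular \<mu> p (\<lambda>x. u x / l) \<le> 1 \<Longrightarrow> Lebesgue_norm \<mu> p u \<le> ennreal l"
  unfolding Lebesgue_norm_def by (intro INF_lower) auto

lemma modular_le_1_of_norm_less: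
  assumes p: "\<And>x. 0 < p x" and less: "Lebesgue_norm \<mu> p u < ennreal l"
  shows "modular \<mu> p (\<lambda>x. u x / l) \<le> 1"
proof -
  obtain k where k: "0 < k" "modular \<mu> p (\<lambda>x. u x / k) \<le> 1" "ennreal k < ennreal l"
    using less unfolding Lebesgue_norm_def INF_less_iff by blast
  have kl: "k \<le> l" using k by (metis ennreal_less_iff less_imp_le)
  have "modular \<mu> p (\<lambda>x. u x / l) \<le> modular \<mu> p (\<lambda>x. u x / k)"
    unfolding modular_def
  proof (intro nn_integral_mono ennreal_leI powr_mono2)
    fix x
    show "0 \<le> real_of_ereal (p x)" using p[of x] by (simp add: real_of_ereal_pos less_imp_le)
    show "\<bar>u x / l\<bar> \<le> \<bar>u x / k\<bar>" using k(1) kl by (simp add: abs_divide frac_le)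
  qed auto
  thus ?thesis using k(2) by (rule order.trans)
qed

text \<open>Translates a bound on the quasi-norm into bounds on modulars, in terms of which the estimates above are phrased.\<close>

lemma Sobolev_norm_unit_ball:
  assumes p: "\<And>x. 0 < p x" and less: "Sobolev_norm \<mu> s p u < ennreal l" and l: "0 < l"
  shows "modular \<mu> p (\<lambda>x. 1 / l * u x) \<le> 1 \<and> (\<exists>g N. g \<in> borel_measurable \<mu> \<and> modular \<mu> p g \<le> 1 \<and> N \<in> null_sets \<mu> \<and>
    gradient_off (\<lambda>x. real_of_ereal (s x)) (\<lambda>x. 1 / l * u x) g N)"
proof
  have "Lebesgue_norm \<mu> p u \<le> Sobolev_norm \<mu> s p u" "Sobolev_seminorm \<mu> s p u \<le> Sobolev_norm \<mu> s p u"
    by (auto simp: Sobolev_norm_def)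
  hence L: "Lebesgue_norm \<mu> p u < ennreal l" and S: "Sobolev_seminorm \<mu> s p u < ennreal l"
    using less by auto
  show "modular \<mu> p (\<lambda>x. 1 / l * u x) \<le> 1" using modular_le_1_of_norm_less[OF p L] by simp
  obtain g where g: "g \<in> scalar_gradients \<mu> s u" "Lebesgue_norm \<mu> p g < ennreal l"
    using S unfolding Sobolev_seminorm_def INF_less_iff by blast
  then obtain N where N: "N \<in> null_sets \<mu>" "gradient_off (\<lambda>x. real_of_ereal (s x)) u g N"
    unfolding scalar_gradients_def gradient_off_def by blast
  have "g \<in> borel_measurable \<mu>" using g(1) by (simp add: scalar_gradients_def)
  hence "(\<lambda>x. 1 / l * g x) \<in> borel_measurable \<mu>" by measurable
  moreover have "modular \<mu> p (\<lambda>x. 1 / l * g x) \<le> 1" using modular_le_1_of_norm_less[OF p g(2)] by simp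
  moreover have "gradient_off (\<lambda>x. real_of_ereal (s x)) (\<lambda>x. 1 / l * u x) (\<lambda>x. 1 / l * g x) N"
    using l by (intro gradient_off_scale N(2)) auto
  ultimately show "\<exists>g N. g \<in> borel_measurable \<mu> \<and> modular \<mu> p g \<le> 1 \<and> N \<in> null_sets \<mu> \<and>
    gradient_off (\<lambda>x. real_of_ereal (s x)) (\<lambda>x. 1 / l * u x) g N" using N(1) by blast
qed

lemma ennreal_pos_less:
  assumes "0 < (\<epsilon> :: ennreal)"
  shows "\<exists>e>0. ennreal e < \<epsilon>"
proof -
  obtain d where d: "0 < d" "d < \<epsilon>" using dense[OF assms] by blast
  have "d < top" using d(2) top_greatest by (rule order.strict_trans2)
  then obtain e where e: "d = ennreal e" "0 \<le> e" by (cases d) auto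
  have "e \<noteq> 0" using d(1) e by auto
  thus ?thesis using d(2) e by (intro exI[of _ e]) auto
qed

text \<open>One representative per class; representatives belong to \<open>F\<close>, as the definition of total boundedness demands.\<close>

lemma norm_totally_boundedI:
  assumes "\<And>e. 0 < e \<Longrightarrow> \<exists>\<phi> :: ('a \<Rightarrow> real) \<Rightarrow> 'c. finite (\<phi> ` F) \<and> (\<forall>u\<in>F. \<forall>v\<in>F. \<phi> u = \<phi> v \<longrightarrow> n (\<lambda>x. u x - v x) \<le> ennreal e)"
  shows "norm_totally_bounded n F"
  unfolding norm_totally_bounded_def
proof (intro allI impI)
  fix \<epsilon> :: ennreal assume "\<epsilon> > 0"
  then obtain e where e: "0 < e" "ennreal e < \<epsilon>" using ennreal_pos_less by blast
  from assms[OF e(1)] obtain \<phi> :: "('a \<Rightarrow> real) \<Rightarrow> 'c" where fin: "finite (\<phi> ` F)"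
    and close: "\<And>u v. u \<in> F \<Longrightarrow> v \<in> F \<Longrightarrow> \<phi> u = \<phi> v \<Longrightarrow> n (\<lambda>x. u x - v x) \<le> ennreal e" by blast
  show "\<exists>K. finite K \<and> K \<subseteq> F \<and> (\<forall>u\<in>F. \<exists>v\<in>K. n (\<lambda>x. u x - v x) < \<epsilon>)"
  proof (intro exI[of _ "inv_into F \<phi> ` \<phi> ` F"] conjI ballI)
    show "inv_into F \<phi> ` \<phi> ` F \<subseteq> F" by (auto intro: inv_into_into)
    fix u assume u: "u \<in> F"
    show "\<exists>v\<in>inv_into F \<phi> ` \<phi> ` F. n (\<lambda>x. u x - v x) < \<epsilon>"
    proof (rule bexI)
      have "n (\<lambda>x. u x - inv_into F \<phi> (\<phi> u) x) \<le> ennreal e"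
        using u by (intro close) (auto intro: inv_into_into simp: f_inv_into_f)
      also have "\<dots> < \<epsilon>" by (rule e(2))
      finally show "n (\<lambda>x. u x - inv_into F \<phi> (\<phi> u) x) < \<epsilon>" .
    qed (use u in blast)
  qed (use fin in blast)
qed

theorem theorem3p9:
  fixes \<mu> :: "'a::metric_space measure"
    and Q p s q :: "'a \<Rightarrow> ereal"
    and H :: "('a \<Rightarrow> 'a) set"
    and x\<^sub>0 :: 'a and r :: real
  assumes "metric_measure_space \<mu>"
    and "geometrically_doubling TYPE('a)"
    and "(SUP x. emeasure \<mu> (ball x 1)) < \<infinity>"
    and "Q \<in> log_exponents \<mu>"
    and "lower_Ahlfors_regular \<mu> Q"
    and "H \<subseteq> Iso \<mu>"
    and "r > 0"
    and "((\<lambda>R::real. INF x\<in>UNIV - ball x\<^sub>0 R. orbit_packing H x r) \<longlongrightarrow> \<infinity>) at_top"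
    and "p \<in> log_exponents \<mu> \<inter> invariant_exponents \<mu> H"
    and "s \<in> log_exponents \<mu>"
    and "esssup \<mu> s \<le> 1"
    and "exponent_much_less \<mu> (\<lambda>x. s x * p x) Q"
    and "q \<in> bounded_exponents \<mu>"
    and "exponent_much_less \<mu> p q"
    and "exponent_much_less \<mu> q (\<lambda>x. Q x * p x / (Q x - s x * p x))"
  shows "compactly_embedded (invariant_Sobolev_space \<mu> H s p) (Sobolev_norm \<mu> s p)
           (Lebesgue_space \<mu> q) (Lebesgue_norm \<mu> q)"
proof -
  obtain Z pm pM sm sM QM c b L where
    "subcritical_exponents \<mu> (\<lambda>x. real_of_ereal (p x)) (\<lambda>x. real_of_ereal (s x)) (\<lambda>x. real_of_ereal (Q x))
       (\<lambda>x. real_of_ereal (q x)) Z pm pM sm sM QM c b L"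
    using assms(1,2,4,5,9,10,12-15) by (auto elim: subcritical_exponents_of_ereal)
  then interpret subcritical_exponents \<mu> "\<lambda>x. real_of_ereal (p x)" "\<lambda>x. real_of_ereal (s x)"
    "\<lambda>x. real_of_ereal (Q x)" "\<lambda>x. real_of_ereal (q x)" Z pm pM sm sM QM c b L .
  have p_pos: "\<And>x. 0 < p x" using assms(9) by (auto simp: invariant_exponents_def exponents_def)
  have p_inv: "\<And>h x. h \<in> H \<Longrightarrow> p (h x) = p x"
    using assms(9) by (auto simp: invariant_exponents_def fun_eq_iff)
  let ?Y = "invariant_Sobolev_space \<mu> H s p"
  obtain \<theta> where \<theta>: "0 < \<theta>" and embed:
    "\<And>w g N. \<lbrakk>w \<in> borel_measurable \<mu>; modular \<mu> p w \<le> 1; g \<in> borel_measurable \<mu>; modular \<mu> p g \<le> 1;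
      N \<in> null_sets \<mu>; gradient_off (\<lambda>x. real_of_ereal (s x)) w g N\<rbrakk> \<Longrightarrow> modular \<mu> q (\<lambda>x. \<theta> * w x) \<le> 1"
    using unit_ball_embedding unfolding modular_def by blast
  have modular_q_le_1: "modular \<mu> q (\<lambda>x. \<theta> * (1 / l * w x)) \<le> 1"
    if w: "w \<in> borel_measurable \<mu>" and l: "0 < l" "Sobolev_norm \<mu> s p w < ennreal l" for w l
  proof -
    have "(\<lambda>x. 1 / l * w x) \<in> borel_measurable \<mu>" using w by measurable
    thus ?thesis using Sobolev_norm_unit_ball[OF p_pos l(2,1)] embed by blast
  qed
  have Y: "u \<in> borel_measurable \<mu>" "\<And>h. h \<in> H \<Longrightarrow> AE x in \<mu>. u (h x) = u x" if "u \<in> ?Y" for u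
    using that by (auto simp: invariant_Sobolev_space_def Sobolev_space_def Lebesgue_space_def)
  have Y_finite: "Sobolev_norm \<mu> s p u < \<infinity>" if u: "u \<in> ?Y" for u
  proof -
    obtain l where l: "0 < l" "modular \<mu> p (\<lambda>x. l * u x) < \<infinity>" and semi: "Sobolev_seminorm \<mu> s p u < \<infinity>"
      using u by (auto simp: invariant_Sobolev_space_def Sobolev_space_def Lebesgue_space_def)
    obtain B where B: "modular \<mu> p (\<lambda>x. l * u x) = ennreal B" "0 \<le> B"
      using l(2) by (cases "modular \<mu> p (\<lambda>x. l * u x)") auto
    obtain h where h: "0 < h" "h \<le> 1" "\<And>h'. 0 \<le> h' \<Longrightarrow> h' \<le> h \<Longrightarrow> h' powr pm * B \<le> 1"
      using small_powr[OF pos(1), of 1 B] B by auto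
    have lu: "(\<lambda>x. l * u x) \<in> borel_measurable \<mu>" using Y(1)[OF u] by measurable
    have "modular \<mu> p (\<lambda>x. h * (l * u x)) \<le> ennreal (h powr pm) * modular \<mu> p (\<lambda>x. l * u x)"
      unfolding modular_def using h by (intro modP_shrink lu) auto
    also have "\<dots> = ennreal (h powr pm * B)" using B by (simp add: ennreal_mult)
    also have "\<dots> \<le> 1" using h(3)[of h] h(1) by (simp add: ennreal_le_1)
    finally have "modular \<mu> p (\<lambda>x. u x / (1 / (h * l))) \<le> 1" by (simp add: mult_ac)
    hence "Lebesgue_norm \<mu> p u \<le> ennreal (1 / (h * l))" using h l by (intro Lebesgue_norm_le) auto
    hence "Lebesgue_norm \<mu> p u < \<infinity>" by (rule order.strict_trans1) simp
    thus ?thesis using semi by (simp add: Sobolev_norm_def)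
  qed
  have finite_bound: "\<exists>l>0. C < ennreal l" if C: "C < \<infinity>" for C :: ennreal
  proof -
    obtain B where "C = ennreal B" "0 \<le> B" using C by (cases C) auto
    thus ?thesis by (intro exI[of _ "B + 1"]) (auto simp: ennreal_less_iff)
  qed
  show ?thesis unfolding compactly_embedded_def
  proof (intro conjI allI impI)
    show "?Y \<subseteq> Lebesgue_space \<mu> q"
    proof
      fix u assume u: "u \<in> ?Y"
      obtain l where l: "0 < l" "Sobolev_norm \<mu> s p u < ennreal l" using finite_bound[OF Y_finite[OF u]] by blast
      have "modular \<mu> q (\<lambda>x. \<theta> / l * u x) < \<infinity>"
        using modular_q_le_1[OF Y(1)[OF u] l] by (auto simp: less_top[symmetric] top_unique)
      thus "u \<in> Lebesgue_space \<mu> q"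
        using Y(1)[OF u] \<theta> l(1) by (auto simp: Lebesgue_space_def intro!: exI[of _ "\<theta> / l"])
    qed
  next
    show "continuous_inclusion ?Y (Sobolev_norm \<mu> s p) (Lebesgue_norm \<mu> q)"
      unfolding continuous_inclusion_def
    proof (intro ballI allI impI)
      fix u and \<epsilon> :: ennreal assume u: "u \<in> ?Y" and "\<epsilon> > 0"
      then obtain e where e0: "0 < e" and e: "ennreal e < \<epsilon>" using ennreal_pos_less by blast
      show "\<exists>\<delta>>0. \<forall>v\<in>?Y. Sobolev_norm \<mu> s p (\<lambda>x. v x - u x) < \<delta> \<longrightarrow> Lebesgue_norm \<mu> q (\<lambda>x. v x - u x) < \<epsilon>"
      proof (intro exI[of _ "ennreal (\<theta> * e)"] conjI ballI impI)
        show "0 < ennreal (\<theta> * e)" using \<theta> e0 by simp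
        fix v assume v: "v \<in> ?Y" and less: "Sobolev_norm \<mu> s p (\<lambda>x. v x - u x) < ennreal (\<theta> * e)"
        have "(\<lambda>x. v x - u x) \<in> borel_measurable \<mu>" using Y(1)[OF u] Y(1)[OF v] by measurable
        from modular_q_le_1[OF this _ less] have "modular \<mu> q (\<lambda>x. (v x - u x) / e) \<le> 1"
          using \<theta> e0 by simp
        hence "Lebesgue_norm \<mu> q (\<lambda>x. v x - u x) \<le> ennreal e" by (rule Lebesgue_norm_le[OF e0])
        thus "Lebesgue_norm \<mu> q (\<lambda>x. v x - u x) < \<epsilon>" using e by (rule order.strict_trans1)
      qed
    qed
  next
    fix F assume F: "F \<subseteq> ?Y" and "norm_bounded (Sobolev_norm \<mu> s p) F"
    then obtain C where C: "C < \<infinity>" "\<And>u. u \<in> F \<Longrightarrow> Sobolev_norm \<mu> s p u \<le> C" by (auto simp: norm_bounded_def)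
    obtain l where l: "0 < l" "C < ennreal l" using finite_bound[OF C(1)] by blast
    define \<nu> where "\<nu> = (\<lambda>(u :: 'a \<Rightarrow> real) x. 1 / l * u x)"
    have unit: "modP (\<nu> u) \<le> 1 \<and> (\<exists>g N. g \<in> borel_measurable \<mu> \<and> modP g \<le> 1 \<and> N \<in> null_sets \<mu> \<and>
        gradient_off (\<lambda>x. real_of_ereal (s x)) (\<nu> u) g N)" if u: "u \<in> F" for u
      unfolding \<nu>_def
      by (rule Sobolev_norm_unit_ball[OF p_pos order.strict_trans1[OF C(2)[OF u] l(2)] l(1), unfolded modular_def])
    show "norm_totally_bounded (Lebesgue_norm \<mu> q) F"
    proof (rule norm_totally_boundedI[where 'c = "'a \<Rightarrow> int"])
      fix e :: real assume e: "0 < e"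
      have meas: "\<nu> u \<in> borel_measurable \<mu>" if "u \<in> F" for u
      proof -
        have [measurable]: "u \<in> borel_measurable \<mu>" using Y(1) F that by blast
        show ?thesis unfolding \<nu>_def by measurable
      qed
      have inv: "AE x in \<mu>. \<nu> u (h x) = \<nu> u x" if "u \<in> F" "h \<in> H" for u h
      proof -
        have "AE x in \<mu>. u (h x) = u x" using Y(2) F that by blast
        thus ?thesis by eventually_elim (simp add: \<nu>_def)
      qed
      obtain \<phi> :: "('a \<Rightarrow> real) \<Rightarrow> 'a \<Rightarrow> int" where fin: "finite (\<phi> ` \<nu> ` F)" and close:
        "\<And>u v. u \<in> \<nu> ` F \<Longrightarrow> v \<in> \<nu> ` F \<Longrightarrow> \<phi> u = \<phi> v \<Longrightarrow>
          (\<integral>\<^sup>+x. ennreal (\<bar>l / e * (u x - v x)\<bar> powr real_of_ereal (q x)) \<partial>\<mu>) \<le> 1"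
      proof (rule finite_classes_in_modular[OF assms(6) _ assms(7,8), where k = "l / e" and F = "\<nu> ` F"])
        show "0 < l / e" using l e by simp
        show "\<exists>g N. g \<in> borel_measurable \<mu> \<and> modP g \<le> 1 \<and> N \<in> null_sets \<mu> \<and>
            gradient_off (\<lambda>x. real_of_ereal (s x)) u g N" if "u \<in> \<nu> ` F" for u
          using that unit by blast
        show "u \<in> borel_measurable \<mu> \<and> modP u \<le> 1" if "u \<in> \<nu> ` F" for u
          using that unit meas by blast
        show "AE x in \<mu>. u (h x) = u x" if "u \<in> \<nu> ` F" "h \<in> H" for u h
          using that inv by blast
      qed (use p_inv in auto)
      show "\<exists>\<psi> :: ('a \<Rightarrow> real) \<Rightarrow> 'a \<Rightarrow> int. finite (\<psi> ` F) \<and> (\<forall>u\<in>F. \<forall>v\<in>F. \<psi> u = \<psi> v \<longrightarrow> Lebesgue_norm \<mu> q (\<lambda>x. u x - v x) \<le> ennreal e)"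
      proof (intro exI[of _ "\<phi> \<circ> \<nu>"] conjI ballI impI)
        show "finite ((\<phi> \<circ> \<nu>) ` F)" using fin by (simp add: image_comp)
        fix u v assume "u \<in> F" "v \<in> F" "(\<phi> \<circ> \<nu>) u = (\<phi> \<circ> \<nu>) v"
        hence "modular \<mu> q (\<lambda>x. l / e * (\<nu> u x - \<nu> v x)) \<le> 1" unfolding modular_def by (intro close) auto
        moreover have "(\<lambda>x. l / e * (\<nu> u x - \<nu> v x)) = (\<lambda>x. (u x - v x) / e)"
          using l(1) e by (simp add: fun_eq_iff \<nu>_def field_simps)
        ultimately show "Lebesgue_norm \<mu> q (\<lambda>x. u x - v x) \<le> ennreal e"
          by (intro Lebesgue_norm_le e) (simp only:)
      qed
    qed
  qed
qed

end
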